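(* Let $d$ be a positive integer. 1. The map $\Psi_d\colon\mathcal{R}\to\mathcal{R}_q/\Phi_d(q)$ defined by $\binom{x}{k}\mapsto\genfrac{[}{]}{0pt}{}{x}{dk}$ for $k\in\mathbb{N}$ and extended $\mathbb{Z}$-linearly is a ring homomorphism. 2. After extending scalars (to $\mathbb{Z}[q,q^{-1}]/\Phi_d(q)$), $\Psi_d$ admits a one-sided inverse $\widetilde{\Psi}_d\colon\mathcal{R}_q/\Phi_d(q)\to\mathcal{R}\otimes_{\mathbb{Z}}\mathbb{Z}[q,q^{-1}]/\Phi_d(q)$ (i.e. $\widetilde{\Psi}_d$ composed after the scalar extension of $\Psi_d$ is the identity), defined linearly over $\mathbb{Z}[q,q^{-1}]/\Phi_d(q)$ by $\widetilde{\Psi}_d\left(\genfrac{[}{]}{0pt}{}{x}{k}\right)=\binom{x}{k/d}$ if $d\mid k$ and $\widetilde{\Psi}_d\left(\genfrac{[}{]}{0pt}{}{x}{k}\right)=0$ otherwise.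
   Context: Here $q$ and $x$ are commuting indeterminates, $\mathbb{N}=\{0,1,2,\dots\}$, and $\Phi_d$ is the $d$th cyclotomic polynomial. For $n\in\mathbb{Z}$, $[n]_q:=(q^n-1)/(q-1)\in\mathbb{Z}[q,q^{-1}]$; for $n\in\mathbb{N}$, $[n]_q!:=[n]_q\cdots[1]_q$ with $[0]_q!:=1$. $\mathcal{R}:=\{P(x)\in\mathbb{Q}[x] : P(n)\in\mathbb{Z}\text{ for all }n\in\mathbb{N}\}$ is a free $\mathbb{Z}$-module with basis $\binom{x}{k}:=\frac{x(x-1)\cdots(x-k+1)}{k!}$ ($k\ge1$), $\binom{x}{0}:=1$. $\mathcal{R}_q:=\{P(x)\in\mathbb{Q}(q)[x] : P([n]_q)\in\mathbb{Z}[q,q^{-1}]\text{ for all }n\in\mathbb{Z}\}$ is a free $\mathbb{Z}[q,q^{-1}]$-module with basis $\genfrac{[}{]}{0pt}{}{x}{k}:=\frac{x(x-[1]_q)\cdots(x-[k-1]_q)}{q^{\binom{k}{2}}[k]_q!}$ ($k\ge1$), $\genfrac{[}{]}{0pt}{}{x}{0}:=1$. $\mathcal{R}_q/\Phi_d(q)$ is the quotient of $\mathcal{R}_q$ by the ideal generated by $\Phi_d(q)$; images of basis elements are denoted by the same symbols. *)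

theory Defs
  imports
    "HOL-Computational_Algebra.Computational_Algebra"
    "HOL-Algebra.Algebraic_Closure_Type"
    "HOL-Algebra.Free_Abelian_Groups"
begin

definition primitive_roots :: "nat \<Rightarrow> complex set" where
  "primitive_roots d = {w. w ^ d = 1 \<and> (\<forall>k. 0 < k \<and> k < d \<longrightarrow> w ^ k \<noteq> 1)}"

definition cyclotomic :: "nat \<Rightarrow> int poly" where
  "cyclotomic d = (THE p. map_poly of_int p = (\<Prod>w\<in>primitive_roots d. [:-w, 1:]))"

text \<open>The description is proper for positive \<open>d\<close>: the product has integer coefficients.\<close>

lemma finite_primitive_roots: "0 < d \<Longrightarrow> finite (primitive_roots d)"
  by (rule finite_subset[OF _ finite_roots_unity[of d]]) (auto simp: primitive_roots_def)

lemma roots_unity_eq_Union_primitive_roots: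
  assumes "0 < d"
  shows "{w. w ^ d = 1} = (\<Union>e\<in>{e. e dvd d}. primitive_roots e)"
proof (intro equalityI subsetI)
  fix w :: complex assume "w \<in> {w. w ^ d = 1}"
  then have w: "w ^ d = 1" by simp
  define e where "e = (LEAST k. 0 < k \<and> w ^ k = 1)"
  have e: "0 < e \<and> w ^ e = 1"
    unfolding e_def by (rule LeastI[of _ d]) (use w assms in auto)
  have min: "w ^ k \<noteq> 1" if "0 < k" "k < e" for k
    using not_less_Least[of k "\<lambda>k. 0 < k \<and> w ^ k = 1"] that by (auto simp: e_def)
  have "w ^ d = (w ^ e) ^ (d div e) * w ^ (d mod e)"
    by (simp add: power_mult[symmetric] power_add[symmetric])
  then have "w ^ (d mod e) = 1" using w e by simp
  then have "d mod e = 0" using min[of "d mod e"] e by (metis gr0I mod_less_divisor)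
  then show "w \<in> (\<Union>e\<in>{e. e dvd d}. primitive_roots e)"
    using e min by (auto simp: primitive_roots_def)
next
  fix w :: complex assume "w \<in> (\<Union>e\<in>{e. e dvd d}. primitive_roots e)"
  then show "w \<in> {w. w ^ d = 1}"
    by (auto simp: primitive_roots_def power_mult elim!: dvdE)
qed

lemma primitive_roots_disjoint:
  assumes "0 < d" "0 < e" "d \<noteq> e"
  shows "primitive_roots d \<inter> primitive_roots e = {}"
  using assms by (auto simp: primitive_roots_def) (metis linorder_neqE_nat)

lemma prod_roots_unity:
  assumes "0 < d"
  shows "(\<Prod>w\<in>{w::complex. w ^ d = 1}. [:-w, 1:]) = Polynomial.monom 1 d - 1"
    (is "?P = ?Q")
proof (rule ccontr)
  assume ne: "?P \<noteq> ?Q"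
  let ?S = "{w::complex. w ^ d = 1}"
  have fin: "finite ?S" and card: "card ?S = d"
    using assms finite_roots_unity[of d] card_roots_unity_eq[of d] by auto
  have degP: "Polynomial.degree ?P = d"
    using card by (subst degree_prod_eq_sum_degree) auto
  have lcP: "lead_coeff ?P = 1"
    by (subst lead_coeff_prod) auto
  have "Polynomial.degree (?P - ?Q) \<le> d"
    using degP assms by (intro Polynomial.degree_diff_le) (auto intro!: Polynomial.degree_diff_le simp: degree_monom_eq)
  moreover have "Polynomial.coeff (?P - ?Q) d = 0"
    using lcP degP assms by (simp add: Polynomial.coeff_diff)
  ultimately have deg: "Polynomial.degree (?P - ?Q) < d"
    using ne by (metis eq_iff_diff_eq_0 le_neq_implies_less leading_coeff_neq_0)
  have "?S \<subseteq> {x. poly (?P - ?Q) x = 0}"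
    using fin by (auto simp: poly_prod poly_monom prod_zero_iff)
  then have "d \<le> card {x. poly (?P - ?Q) x = 0}"
    using card ne by (metis card_mono poly_roots_finite right_minus_eq)
  also have "\<dots> \<le> Polynomial.degree (?P - ?Q)"
    using ne by (intro card_poly_roots_bound) auto
  finally show False using deg by simp
qed

lemma cyclotomic_exists:
  "0 < d \<Longrightarrow> \<exists>p::int poly. map_poly of_int p = (\<Prod>w\<in>primitive_roots d. [:-w, 1:])"
proof (induction d rule: less_induct)
  case (less d)
  define C where "C = (\<lambda>e. \<Prod>w\<in>primitive_roots e. [:-w, 1:])"
  define D where "D = {e. e dvd d \<and> e \<noteq> d}"
  have D: "finite D" "\<And>e. e \<in> D \<Longrightarrow> 0 < e \<and> e < d"
    using less.prems by (auto simp: D_def dest: dvd_imp_le intro: Nat.gr0I le_neq_implies_less)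
  have "\<forall>e\<in>D. \<exists>p::int poly. map_poly of_int p = C e"
    using less.IH D(2) by (auto simp: C_def)
  then obtain c :: "nat \<Rightarrow> int poly" where c: "\<And>e. e \<in> D \<Longrightarrow> map_poly of_int (c e) = C e"
    by metis
  define P where "P = (\<Prod>e\<in>D. c e)"
  have hom_mult: "map_poly of_int (p * r) = map_poly of_int p * (map_poly of_int r :: complex poly)"
    for p r :: "int poly"
    by (simp add: poly_eq_iff Polynomial.coeff_mult coeff_map_poly)
  have hom_add: "map_poly of_int (p + r) = map_poly of_int p + (map_poly of_int r :: complex poly)"
    for p r :: "int poly"
    by (simp add: poly_eq_iff coeff_map_poly)
  have hom_prod: "map_poly of_int (\<Prod>e\<in>E. c e) = (\<Prod>e\<in>E. map_poly of_int (c e) :: complex poly)"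
    if "finite E" for E
    using that by (induction E rule: finite_induct) (simp_all add: hom_mult)
  have P: "map_poly of_int P = (\<Prod>e\<in>D. C e)"
    using c D(1) by (simp add: P_def hom_prod)
  have "Polynomial.monom 1 d - 1 = (\<Prod>e\<in>{e. e dvd d}. C e)"
    unfolding prod_roots_unity[OF less.prems, symmetric] C_def
      roots_unity_eq_Union_primitive_roots[OF less.prems]
    using less.prems
    by (intro prod.UNION_disjoint ballI impI finite_primitive_roots primitive_roots_disjoint)
      (auto intro: Nat.gr0I)
  also have "{e. e dvd d} = insert d D" by (auto simp: D_def)
  finally have eq: "Polynomial.monom 1 d - 1 = (\<Prod>e\<in>D. C e) * C d"
    using D by (auto simp: D_def mult.commute)
  have lc: "lead_coeff (\<Prod>e\<in>D. C e) = 1"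
    by (simp add: C_def lead_coeff_prod)
  have degP: "Polynomial.degree P = Polynomial.degree (\<Prod>e\<in>D. C e)"
    unfolding P[symmetric] by (simp add: degree_map_poly)
  have lcP: "lead_coeff P = 1"
    using lc unfolding P[symmetric] by (simp add: degree_map_poly coeff_map_poly)
  then have "P \<noteq> 0" by auto
  obtain Q R where QR: "pseudo_divmod (Polynomial.monom 1 d - 1) P = (Q, R)"
    by (cases "pseudo_divmod (Polynomial.monom 1 d - 1) P")
  from pseudo_divmod[OF \<open>P \<noteq> 0\<close> QR] lcP
  have div: "Polynomial.monom 1 d - 1 = P * Q + R"
    and R: "R = 0 \<or> Polynomial.degree R < Polynomial.degree P" by auto
  have "map_poly of_int (Polynomial.monom 1 d - 1 :: int poly) = (Polynomial.monom 1 d - 1 :: complex poly)"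
    by (simp add: poly_eq_iff coeff_map_poly)
  then have "(\<Prod>e\<in>D. C e) * C d = (\<Prod>e\<in>D. C e) * map_poly of_int Q + map_poly of_int R"
    using eq div by (metis hom_add hom_mult P)
  then have *: "(\<Prod>e\<in>D. C e) * (C d - map_poly of_int Q) = map_poly of_int R"
    by (simp add: algebra_simps)
  have "C d = map_poly of_int Q"
  proof (rule ccontr)
    assume "C d \<noteq> map_poly of_int Q"
    then have "C d - map_poly of_int Q \<noteq> 0" by simp
    moreover have "(\<Prod>e\<in>D. C e) \<noteq> 0" using lc by auto
    ultimately have "map_poly of_int R \<noteq> (0 :: complex poly)"
      and "Polynomial.degree P \<le> Polynomial.degree (map_poly of_int R :: complex poly)"
      unfolding *[symmetric] degP by (auto simp: Polynomial.degree_mult_eq)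
    then show False using R by (auto simp: degree_map_poly)
  qed
  then show ?case by (auto simp: C_def)
qed

lemma of_int_poly_cyclotomic:
  assumes "0 < d"
  shows "map_poly of_int (cyclotomic d) = (\<Prod>w\<in>primitive_roots d. [:-w, 1:])"
proof -
  obtain p :: "int poly" where p: "map_poly of_int p = (\<Prod>w\<in>primitive_roots d. [:-w, 1:])"
    using cyclotomic_exists[OF assms] by blast
  show ?thesis unfolding cyclotomic_def
  proof (rule theI[of _ p])
    fix r :: "int poly" assume "map_poly of_int r = (\<Prod>w\<in>primitive_roots d. [:-w, 1:])"
    then have "map_poly of_int r = (map_poly of_int p :: complex poly)" using p by simp
    then show "r = p" by (simp add: poly_eq_iff coeff_map_poly)
  qed (rule p)
qed

definition int_valued_polys :: "rat poly ring" where
  "int_valued_polys = ring_of_type_algebra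
     \<lparr>carrier := {P. \<forall>n::nat. poly P (of_nat n) \<in> \<int>}\<rparr>"

definition binom_poly :: "nat \<Rightarrow> rat poly" where
  "binom_poly k = Polynomial.smult (1 / fact k) (\<Prod>i<k. [:- of_nat i, 1:])"

type_synonym qrat = "rat poly fract"

definition q_indet :: qrat where
  "q_indet = to_fract [:0, 1:]"

text \<open>The value at \<^const>\<open>q_indet\<close> of a polynomial with integer coefficients.\<close>

definition poly_in_q :: "int poly \<Rightarrow> qrat" where
  "poly_in_q p = to_fract (map_poly of_int p)"

definition laurent_ring :: "qrat ring" where
  "laurent_ring = ring_of_type_algebra\<lparr>carrier := {poly_in_q p / q_indet ^ n | p n. True}\<rparr>"

definition qint :: "int \<Rightarrow> qrat" where
  "qint n = (q_indet powi n - 1) / (q_indet - 1)"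

definition qfact :: "nat \<Rightarrow> qrat" where
  "qfact n = (\<Prod>i=1..n. qint (int i))"

definition q_int_valued_polys :: "qrat poly ring" where
  "q_int_valued_polys = ring_of_type_algebra
     \<lparr>carrier := {P. \<forall>n::int. poly P (qint n) \<in> carrier laurent_ring}\<rparr>"

text \<open>The factor for \<open>i = 0\<close> is \<open>x\<close> itself, since \<open>qint 0 = 0\<close>.\<close>

definition qbinom_poly :: "nat \<Rightarrow> qrat poly" where
  "qbinom_poly k = Polynomial.smult (1 / (q_indet ^ (k choose 2) * qfact k))
     (\<Prod>i<k. [:- qint (int i), 1:])"

definition laurent_ideal :: "nat \<Rightarrow> qrat set" where
  "laurent_ideal d = genideal laurent_ring {poly_in_q (cyclotomic d)}"

definition cyc_ring :: "nat \<Rightarrow> qrat set ring" where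
  "cyc_ring d = laurent_ring Quot laurent_ideal d"

definition qpoly_ideal :: "nat \<Rightarrow> qrat poly set" where
  "qpoly_ideal d = genideal q_int_valued_polys {[:poly_in_q (cyclotomic d):]}"

abbreviation qpoly_class :: "nat \<Rightarrow> qrat poly \<Rightarrow> qrat poly set" where
  "qpoly_class d P \<equiv> qpoly_ideal d +>\<^bsub>q_int_valued_polys\<^esub> P"

text \<open>The quotient ring of the quantum integer-valued polynomials, together with its structure of
  algebra over \<^term>\<open>cyc_ring d\<close>: scalars act through representatives, in the same way
  as \<^const>\<open>rcoset_mult\<close> multiplies cosets.\<close>

definition q_quotient :: "nat \<Rightarrow> (qrat set, qrat poly set) module" where
  "q_quotient d = ring.extend (q_int_valued_polys Quot qpoly_ideal d)
     \<lparr>module.smult = (\<lambda>a C. \<Union>u\<in>a. \<Union>P\<in>C. qpoly_class d (Polynomial.smult u P))\<rparr>"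

text \<open>The tensor product over the integers of the additive groups of \<open>R\<close> and \<open>A\<close>: the free
  Abelian group on pairs modulo biadditivity (balancedness over the integers is then
  automatic).\<close>

definition tensor_free :: "('r, 'm) ring_scheme \<Rightarrow> ('a, 'n) ring_scheme \<Rightarrow> ('r \<times> 'a \<Rightarrow>\<^sub>0 int) monoid" where
  "tensor_free R A = free_Abelian_group (carrier R \<times> carrier A)"

definition tensor_relations :: "('r, 'm) ring_scheme \<Rightarrow> ('a, 'n) ring_scheme \<Rightarrow> ('r \<times> 'a \<Rightarrow>\<^sub>0 int) set" where
  "tensor_relations R A = generate (tensor_free R A)
     ({frag_of (r \<oplus>\<^bsub>R\<^esub> s, a) - frag_of (r, a) - frag_of (s, a) | r s a.
         r \<in> carrier R \<and> s \<in> carrier R \<and> a \<in> carrier A} \<union>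
      {frag_of (r, a \<oplus>\<^bsub>A\<^esub> b) - frag_of (r, a) - frag_of (r, b) | r a b.
         r \<in> carrier R \<and> a \<in> carrier A \<and> b \<in> carrier A})"

abbreviation tensor_class ::
  "('r, 'm) ring_scheme \<Rightarrow> ('a, 'n) ring_scheme \<Rightarrow> ('r \<times> 'a \<Rightarrow>\<^sub>0 int) \<Rightarrow> ('r \<times> 'a \<Rightarrow>\<^sub>0 int) set" where
  "tensor_class R A c \<equiv> tensor_relations R A #>\<^bsub>tensor_free R A\<^esub> c"

definition pure_tensor ::
  "('r, 'm) ring_scheme \<Rightarrow> ('a, 'n) ring_scheme \<Rightarrow> 'r \<Rightarrow> 'a \<Rightarrow> ('r \<times> 'a \<Rightarrow>\<^sub>0 int) set" where
  "pure_tensor R A r a = tensor_class R A (frag_of (r, a))"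

text \<open>Multiplication is the biadditive extension of \<open>(r \<otimes> a) (s \<otimes> b) = rs \<otimes> ab\<close>, and scalars
  act by \<open>a (r \<otimes> b) = r \<otimes> ab\<close>; both are computed on representatives.\<close>

definition scalar_ext ::
  "('r, 'm) ring_scheme \<Rightarrow> ('a, 'n) ring_scheme \<Rightarrow> ('a, ('r \<times> 'a \<Rightarrow>\<^sub>0 int) set) module" where
  "scalar_ext R A = \<lparr>
     carrier = carrier (tensor_free R A Mod tensor_relations R A),
     monoid.mult = (\<lambda>C D. \<Union>c\<in>C. \<Union>e\<in>D. tensor_class R A
       (frag_extend (\<lambda>(r, a). frag_extend (\<lambda>(s, b). frag_of (r \<otimes>\<^bsub>R\<^esub> s, a \<otimes>\<^bsub>A\<^esub> b)) e) c)),
     one = pure_tensor R A \<one>\<^bsub>R\<^esub> \<one>\<^bsub>A\<^esub>,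
     ring.zero = \<one>\<^bsub>tensor_free R A Mod tensor_relations R A\<^esub>,
     add = monoid.mult (tensor_free R A Mod tensor_relations R A),
     module.smult = (\<lambda>a C. \<Union>c\<in>C. tensor_class R A
       (frag_extend (\<lambda>(r, b). frag_of (r, a \<otimes>\<^bsub>A\<^esub> b)) c))\<rparr>"

text \<open>Maps are taken in \<^term>\<open>extensional\<close> form, so that a map given by its values
  on the carrier is unique as a HOL function. Linearity over the integers is additivity.\<close>

definition additive_maps :: "('a, 'm) ring_scheme \<Rightarrow> ('b, 'n) ring_scheme \<Rightarrow> ('a \<Rightarrow> 'b) set" where
  "additive_maps M N = extensional (carrier M) \<inter> hom (add_monoid M) (add_monoid N)"

definition linear_maps ::
  "('a, 'k) ring_scheme \<Rightarrow> ('a, 'b, 'm) module_scheme \<Rightarrow> ('a, 'c, 'n) module_scheme \<Rightarrow> ('b \<Rightarrow> 'c) set" where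
  "linear_maps A M N = {f \<in> additive_maps M N.
     \<forall>a\<in>carrier A. \<forall>x\<in>carrier M. f (a \<odot>\<^bsub>M\<^esub> x) = a \<odot>\<^bsub>N\<^esub> f x}"

definition is_Psi :: "nat \<Rightarrow> (rat poly \<Rightarrow> qrat poly set) \<Rightarrow> bool" where
  "is_Psi d f \<longleftrightarrow> f \<in> additive_maps int_valued_polys (q_quotient d) \<and>
     (\<forall>k. f (binom_poly k) = qpoly_class d (qbinom_poly (d * k)))"

abbreviation ext_ring :: "nat \<Rightarrow> (qrat set, (rat poly \<times> qrat set \<Rightarrow>\<^sub>0 int) set) module" where
  "ext_ring d \<equiv> scalar_ext int_valued_polys (cyc_ring d)"

abbreviation ext_tensor :: "nat \<Rightarrow> rat poly \<Rightarrow> qrat set \<Rightarrow> (rat poly \<times> qrat set \<Rightarrow>\<^sub>0 int) set" where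
  "ext_tensor d \<equiv> pure_tensor int_valued_polys (cyc_ring d)"

text \<open>\<open>g\<close> is the extension of scalars of \<open>f\<close>, sending \<open>P \<otimes> a\<close> to \<open>a f(P)\<close>.\<close>

definition is_extension_of ::
  "nat \<Rightarrow> (rat poly \<Rightarrow> qrat poly set) \<Rightarrow> ((rat poly \<times> qrat set \<Rightarrow>\<^sub>0 int) set \<Rightarrow> qrat poly set) \<Rightarrow> bool" where
  "is_extension_of d f g \<longleftrightarrow> g \<in> linear_maps (cyc_ring d) (ext_ring d) (q_quotient d) \<and>
     (\<forall>P\<in>carrier int_valued_polys. \<forall>a\<in>carrier (cyc_ring d).
        g (ext_tensor d P a) = a \<odot>\<^bsub>q_quotient d\<^esub> f P)"

definition is_Psi_tilde ::
  "nat \<Rightarrow> (qrat poly set \<Rightarrow> (rat poly \<times> qrat set \<Rightarrow>\<^sub>0 int) set) \<Rightarrow> bool" where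
  "is_Psi_tilde d h \<longleftrightarrow> h \<in> linear_maps (cyc_ring d) (q_quotient d) (ext_ring d) \<and>
     (\<forall>k. h (qpoly_class d (qbinom_poly k)) =
        (if d dvd k then ext_tensor d (binom_poly (k div d)) \<one>\<^bsub>cyc_ring d\<^esub>
         else \<zero>\<^bsub>ext_ring d\<^esub>))"

end

theory Submission
  imports Defs
begin

text \<open>
  Everything rests on the values of a polynomial at the quantum integers \<open>[n]\<^sub>q\<close>
  with \<open>n \<ge> 0\<close>. A quantum integer-valued polynomial is a Laurent combination of the
  quantum binomials, and the matrix of values of these at the \<open>[n]\<^sub>q\<close> is unitriangular.
  Consequently such a polynomial lies in the ideal of \<open>\<Phi>\<^sub>d\<close> as soon as
  all those values are divisible by \<open>\<Phi>\<^sub>d\<close> (\<open>qpoly_idealI\<close>): evaluation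
  embeds the quotient ring into sequences of residues modulo \<open>\<Phi>\<^sub>d\<close>.

  The quantum binomial of index \<open>d k\<close> has at \<open>[n]\<^sub>q\<close> the Gaussian binomial
  of \<open>n\<close> over \<open>d k\<close> as its value, and the \<open>q\<close>-Lucas theorem says that
  modulo \<open>\<Phi>\<^sub>d\<close> this is the ordinary binomial of \<open>n div d\<close> over
  \<open>k\<close> (\<open>gaussian_lucas\<close>, \<open>qbinom_congruence\<close>). Hence \<open>\<Psi>\<^sub>d P\<close>
  has the value \<open>P (n div d)\<close> at \<open>[n]\<^sub>q\<close> (\<open>psi_eval\<close>). Seen through
  evaluation, \<open>\<Psi>\<^sub>d\<close> is thus substitution of \<open>n div d\<close>, which is visibly
  compatible with products; this is \<open>psi_mult\<close>.

  The \<open>q\<close>-Lucas theorem is proved for an arbitrary element \<open>w\<close> of an integral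
  domain with \<open>w ^ d = 1\<close> and no smaller positive power equal to \<open>1\<close>. It transfers to
  residues modulo \<open>\<Phi>\<^sub>d\<close> because an integer polynomial that vanishes at all complex
  primitive \<open>d\<close>-th roots of unity is divisible by the monic polynomial
  \<open>\<Phi>\<^sub>d\<close> (\<open>cyclotomic_dvd\<close>).

  The linear maps in the statement exist and are unique because the binomials are bases. Both
  families are instances of Newton interpolation, so that the coefficient of each basis element is
  a linear functional given by an explicit recursion; \<open>\<Psi>\<^sub>d\<close> and its one-sided inverse
  are written down with these functionals. The left inverse
  property need only be checked on pure tensors of basis elements, where it is the
  definition of the two maps.
\<close>

section \<open>Subrings of a type and their principal quotients\<close>

text \<open>The rings of the statement are subsets of a type with ring operations. Keeping the operations
  of the type allows computations with its simplification rules; only the passage to cosets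
  needs record-based rings.\<close>

locale subring_of_type =
  fixes S :: "'a::comm_ring_1 set"
  assumes one_closed: "1 \<in> S"
    and diff_closed: "x \<in> S \<Longrightarrow> y \<in> S \<Longrightarrow> x - y \<in> S"
    and mult_closed: "x \<in> S \<Longrightarrow> y \<in> S \<Longrightarrow> x * y \<in> S"
begin

lemma zero_closed: "0 \<in> S"
  using diff_closed[OF one_closed one_closed] by simp

lemma uminus_closed: "x \<in> S \<Longrightarrow> - x \<in> S"
  using diff_closed[OF zero_closed] by fastforce

lemma add_closed: "x \<in> S \<Longrightarrow> y \<in> S \<Longrightarrow> x + y \<in> S"
  using diff_closed[OF _ uminus_closed] by fastforce

lemma sum_closed: "(\<And>i. i \<in> I \<Longrightarrow> f i \<in> S) \<Longrightarrow> sum f I \<in> S"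
  by (induction I rule: infinite_finite_induct) (auto intro: zero_closed add_closed)

lemma power_closed: "x \<in> S \<Longrightarrow> x ^ n \<in> S"
  by (induction n) (auto intro: one_closed mult_closed)

end

context subring_of_type
begin

abbreviation ring_on :: "'a ring" where
  "ring_on \<equiv> ring_of_type_algebra\<lparr>carrier := S\<rparr>"

lemma ring_on_simps:
  "carrier ring_on = S"
  "x \<otimes>\<^bsub>ring_of_type_algebra\<^esub> y = x * y" "x \<oplus>\<^bsub>ring_of_type_algebra\<^esub> y = x + y"
  "\<one>\<^bsub>ring_of_type_algebra\<^esub> = 1" "\<zero>\<^bsub>ring_of_type_algebra\<^esub> = 0"
  by (simp_all add: ring_of_type_algebra_def)

lemma cring_ring_on: "cring ring_on"
proof (rule cringI)
  show "abelian_group ring_on"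
  proof (rule abelian_groupI)
    fix x assume "x \<in> carrier ring_on"
    then show "\<exists>y\<in>carrier ring_on. y \<oplus>\<^bsub>ring_on\<^esub> x = \<zero>\<^bsub>ring_on\<^esub>"
      by (intro bexI[of _ "- x"]) (simp_all add: ring_on_simps uminus_closed)
  qed (simp_all add: ring_on_simps add_closed zero_closed algebra_simps)
  show "comm_monoid ring_on"
    by (rule comm_monoidI) (simp_all add: ring_on_simps mult_closed one_closed algebra_simps)
qed (simp add: ring_on_simps algebra_simps)

context
  fixes c assumes c: "c \<in> S"
begin

abbreviation "princ \<equiv> genideal ring_on {c}"
abbreviation "coset u \<equiv> princ +>\<^bsub>ring_on\<^esub> u"
abbreviation "quot_ring \<equiv> ring_on Quot princ"

text \<open>The generated ideal is an intersection of ideals; in a commutative ring it is the set of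
  multiples, which is the form all later computations use.\<close>

lemma princ_eq: "princ = (\<lambda>s. c * s) ` S"
proof -
  have "princ = cgenideal ring_on c"
    using cring.cgenideal_eq_genideal[OF cring_ring_on, of c] c by (simp add: ring_on_simps)
  then show ?thesis
    by (auto simp: cgenideal_def ring_on_simps mult.commute)
qed

lemma ideal_princ: "ideal princ ring_on"
  using ring.genideal_ideal[OF cring.axioms(1)[OF cring_ring_on], of "{c}"] c
  by (simp add: ring_on_simps)

lemma cring_quotient: "cring quot_ring"
  by (rule ideal.quotient_is_cring[OF ideal_princ cring_ring_on])

lemma coset_eq: "coset u = (\<lambda>s. c * s + u) ` S"
  by (auto simp: a_r_coset_def r_coset_def princ_eq ring_on_simps)

lemma coset_self: "u \<in> coset u"
  unfolding coset_eq using zero_closed by force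

lemma coset_eq_iff: "coset u = coset v \<longleftrightarrow> u - v \<in> princ"
proof
  assume "coset u = coset v"
  then have "u \<in> coset v"
    using coset_self by blast
  then show "u - v \<in> princ"
    unfolding coset_eq by (auto simp: princ_eq)
next
  assume "u - v \<in> princ"
  then obtain t where t: "t \<in> S" "u - v = c * t"
    by (auto simp: princ_eq)
  then have u: "u = c * t + v"
    by (metis diff_add_cancel)
  have "w \<in> coset u \<longleftrightarrow> w \<in> coset v" for w
  proof
    assume "w \<in> coset u"
    then obtain s where "s \<in> S" "w = c * s + u"
      unfolding coset_eq by auto
    then show "w \<in> coset v"
      using t unfolding coset_eq by (auto simp: u algebra_simps intro!: image_eqI[of _ _ "s + t"] add_closed)
  next
    assume "w \<in> coset v"
    then obtain s where "s \<in> S" "w = c * s + v"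
      unfolding coset_eq by auto
    then show "w \<in> coset u"
      using t unfolding coset_eq by (auto simp: u algebra_simps intro!: image_eqI[of _ _ "s - t"] diff_closed)
  qed
  then show "coset u = coset v"
    by blast
qed

lemma in_cosetD:
  assumes "v \<in> coset u" "u \<in> S"
  shows "v \<in> S" "v - u \<in> princ"
proof -
  from assms obtain s where s: "s \<in> S" "v = c * s + u"
    unfolding coset_eq by auto
  then show "v \<in> S" "v - u \<in> princ"
    using c assms(2) by (auto simp: princ_eq intro: add_closed mult_closed)
qed

lemma quotient_simps:
  "carrier quot_ring = coset ` S"
  "u \<in> S \<Longrightarrow> v \<in> S \<Longrightarrow> coset u \<oplus>\<^bsub>quot_ring\<^esub> coset v = coset (u + v)"
  "u \<in> S \<Longrightarrow> v \<in> S \<Longrightarrow> coset u \<otimes>\<^bsub>quot_ring\<^esub> coset v = coset (u * v)"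
  "\<one>\<^bsub>quot_ring\<^esub> = coset 1"
  "\<zero>\<^bsub>quot_ring\<^esub> = coset 0"
proof -
  interpret ideal princ ring_on by (rule ideal_princ)
  show "carrier quot_ring = coset ` S"
    by (auto simp: FactRing_def A_RCOSETS_defs a_r_coset_def ring_on_simps)
  show "coset u \<oplus>\<^bsub>quot_ring\<^esub> coset v = coset (u + v)"
       "coset u \<otimes>\<^bsub>quot_ring\<^esub> coset v = coset (u * v)" if "u \<in> S" "v \<in> S"
    using rcos_ring_hom that by (auto simp: ring_hom_def ring_on_simps)
  show "\<one>\<^bsub>quot_ring\<^esub> = coset 1"
    by (simp add: FactRing_simps ring_on_simps)
  show "\<zero>\<^bsub>quot_ring\<^esub> = coset 0"
    unfolding coset_eq by (simp add: FactRing_simps princ_eq)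
qed

end
end

section \<open>Newton interpolation\<close>

text \<open>Polynomials \<open>b k\<close> whose values at the nodes form a unitriangular matrix over the subring
  \<open>S\<close>. They form an \<open>S\<close>-basis of the polynomials with values in \<open>S\<close> at
  the nodes: the coefficients are found by forward substitution, which never divides.\<close>

locale newton_basis = subring_of_type S for S :: "'a::field set" +
  fixes x :: "nat \<Rightarrow> 'a" and b :: "nat \<Rightarrow> 'a poly"
  assumes degree_basis: "Polynomial.degree (b k) \<le> k"
    and basis_closed: "poly (b k) (x n) \<in> S"
    and basis_eq_0: "n < k \<Longrightarrow> poly (b k) (x n) = 0"
    and basis_eq_1: "poly (b k) (x k) = 1"
begin

text \<open>Forward substitution: the values at \<open>x 0, \<dots>, x n\<close> determine the first
  coefficients, and \<open>b n\<close> takes the value \<open>1\<close> at \<open>x n\<close>.\<close>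

fun coef :: "'a poly \<Rightarrow> nat \<Rightarrow> 'a" where
  "coef P n = poly P (x n) - (\<Sum>k<n. coef P k * poly (b k) (x n))"

declare coef.simps [simp del]

lemma poly_eq_sum_coef: "poly P (x n) = (\<Sum>k\<le>n. coef P k * poly (b k) (x n))"
  by (simp add: lessThan_Suc_atMost[symmetric] basis_eq_1 coef.simps[of P n])

lemma coef_add: "coef (P + Q) n = coef P n + coef Q n"
proof (induction n rule: less_induct)
  case (less n)
  then have "(\<Sum>k<n. coef (P + Q) k * poly (b k) (x n)) =
      (\<Sum>k<n. coef P k * poly (b k) (x n)) + (\<Sum>k<n. coef Q k * poly (b k) (x n))"
    by (simp add: distrib_right sum.distrib)
  then show ?case
    by (simp add: coef.simps[of _ n])
qed

lemma coef_smult: "coef (Polynomial.smult a P) n = a * coef P n"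
proof (induction n rule: less_induct)
  case (less n)
  then have "(\<Sum>k<n. coef (Polynomial.smult a P) k * poly (b k) (x n)) =
      a * (\<Sum>k<n. coef P k * poly (b k) (x n))"
    by (simp add: sum_distrib_left mult.assoc)
  then show ?case
    by (simp add: coef.simps[of _ n] right_diff_distrib)
qed

lemma coef_0: "coef 0 n = 0"
  using coef_smult[of 0 0 n] by simp

lemma coef_sum: "coef (\<Sum>i\<in>I. f i) n = (\<Sum>i\<in>I. coef (f i) n)"
  by (induction I rule: infinite_finite_induct) (simp_all add: coef_0 coef_add)

lemma coef_basis: "coef (b j) k = (if k = j then 1 else 0)"
proof (induction k rule: less_induct)
  case (less k)
  have "(\<Sum>i<k. coef (b j) i * poly (b i) (x k)) = (\<Sum>i<k. if i = j then poly (b j) (x k) else 0)"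
    by (rule sum.cong) (use less in auto)
  also have "\<dots> = (if j < k then poly (b j) (x k) else 0)"
    by simp
  finally show ?case
    using basis_eq_0[of k j] basis_eq_1[of j] by (subst coef.simps) (cases k j rule: linorder_cases; simp)
qed

lemma coef_combination:
  assumes "finite I"
  shows "coef (\<Sum>k\<in>I. Polynomial.smult (c k) (b k)) j = (if j \<in> I then c j else 0)"
  using assms by (simp add: coef_sum coef_smult coef_basis if_distrib cong: if_cong)

lemma coef_closed:
  assumes "\<And>n. poly P (x n) \<in> S"
  shows "coef P n \<in> S"
proof (induction n rule: less_induct)
  case (less n)
  then show ?case
    by (subst coef.simps) (auto intro!: diff_closed sum_closed mult_closed assms basis_closed)
qed

lemma inj_nodes: "inj x"
proof (rule linorder_injI)
  fix m n :: nat assume "m < n"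
  then show "x m \<noteq> x n"
    using basis_eq_0[of m n] basis_eq_1[of n] by auto
qed

text \<open>The difference of both sides has degree at most \<open>N\<close> and vanishes at the \<open>N + 1\<close>
  nodes \<open>x 0, \<dots>, x N\<close>, which are distinct by unitriangularity.\<close>

lemma expansion:
  assumes "Polynomial.degree P \<le> N"
  shows "(\<Sum>k\<le>N. Polynomial.smult (coef P k) (b k)) = P"
proof (rule ccontr)
  define D where "D = (\<Sum>k\<le>N. Polynomial.smult (coef P k) (b k)) - P"
  assume "(\<Sum>k\<le>N. Polynomial.smult (coef P k) (b k)) \<noteq> P"
  then have "D \<noteq> 0"
    by (simp add: D_def)
  have "poly D (x n) = 0" if "n \<le> N" for n
  proof -
    have "(\<Sum>k\<le>N. coef P k * poly (b k) (x n)) = (\<Sum>k\<le>n. coef P k * poly (b k) (x n))"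
      by (rule sum.mono_neutral_right) (use that basis_eq_0 in auto)
    then show ?thesis
      by (simp add: D_def poly_sum poly_eq_sum_coef[of P n])
  qed
  then have "card (x ` {..N}) \<le> card {z. poly D z = 0}"
    by (intro card_mono poly_roots_finite[OF \<open>D \<noteq> 0\<close>]) auto
  also have "\<dots> \<le> Polynomial.degree D"
    by (rule card_poly_roots_bound[OF \<open>D \<noteq> 0\<close>])
  also have "\<dots> \<le> N"
    unfolding D_def using assms degree_basis
    by (intro Polynomial.degree_diff_le degree_sum_le)
      (auto intro: order_trans[OF Polynomial.degree_smult_le] order_trans)
  finally show False
    by (simp add: card_image inj_on_subset[OF inj_nodes])
qed

lemma coef_eq_0:
  assumes "Polynomial.degree P < n"
  shows "coef P n = 0"
  using coef_combination[of "{..Polynomial.degree P}" "coef P" n] expansion[of P] assms by simp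

text \<open>Sums over the coefficients of several polynomials can be given a common range, which makes
  maps defined by such sums additive.\<close>

lemma sum_coef_extend:
  assumes "Polynomial.degree P \<le> N" and "\<And>k. h k 0 = 0"
  shows "(\<Sum>k\<le>Polynomial.degree P. h k (coef P k)) = (\<Sum>k\<le>N. h k (coef P k))"
  by (rule sum.mono_neutral_left) (use assms coef_eq_0 in auto)

lemma span_induct:
  assumes "\<And>n. poly P (x n) \<in> S"
    and basis: "\<And>c k. c \<in> S \<Longrightarrow> \<Phi> (Polynomial.smult c (b k))"
    and add: "\<And>u v. \<Phi> u \<Longrightarrow> \<Phi> v \<Longrightarrow> \<Phi> (u + v)"
  shows "\<Phi> P"
proof -
  have "\<Phi> (\<Sum>k\<in>I. Polynomial.smult (coef P k) (b k))" if "finite I" for I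
    using that
  proof induction
    case empty
    show ?case
      using basis[OF zero_closed, of 0] by simp
  qed (auto intro: basis add coef_closed assms(1))
  then show ?thesis
    using expansion[of P] by (metis finite_atMost order_refl)
qed

end

lemma poly_binom_poly: "poly (binom_poly k) (of_nat n) = of_nat (n choose k)"
  by (simp add: binom_poly_def poly_prod binomial_gbinomial gbinomial_prod_rev lessThan_atLeast0)

interpretation newton: newton_basis "\<int> :: rat set" of_nat binom_poly
proof
  fix n k :: nat
  show "Polynomial.degree (binom_poly k) \<le> k"
    unfolding binom_poly_def
    by (rule order_trans[OF Polynomial.degree_smult_le]) (simp add: Polynomial.degree_prod_eq_sum_degree)
qed (auto simp: poly_binom_poly)

section \<open>Gaussian binomials and the q-Lucas theorem\<close>

text \<open>Defined by the \<open>q\<close>-Pascal rule for an arbitrary base, so that the same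
  function serves for the indeterminate, for its image in the field of fractions and for complex
  roots of unity.\<close>

fun gaussian :: "'a::comm_ring_1 \<Rightarrow> nat \<Rightarrow> nat \<Rightarrow> 'a" where
  "gaussian w n 0 = 1"
| "gaussian w 0 (Suc k) = 0"
| "gaussian w (Suc n) (Suc k) = gaussian w n k + w ^ Suc k * gaussian w n (Suc k)"

lemma gaussian_eq_0: "n < k \<Longrightarrow> gaussian w n k = 0"
  by (induction w n k rule: gaussian.induct) auto

lemma gaussian_self: "gaussian w n n = 1"
  by (induction n) (auto simp: gaussian_eq_0)

text \<open>The product formula in a form free of division. It forces the inner entries of row \<open>d\<close>
  to vanish at a primitive \<open>d\<close>-th root of unity.\<close>

lemma gaussian_absorption:
  "(1 - w ^ Suc k) * gaussian w (Suc n) (Suc k) = (1 - w ^ Suc n) * gaussian w n k"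
proof (induction n arbitrary: k)
  case 0
  show ?case by (cases k) auto
next
  case (Suc n)
  show ?case
  proof (cases k)
    case 0
    have "(1 - w) * (1 + w * gaussian w (Suc n) 1) = (1 - w) + w * ((1 - w) * gaussian w (Suc n) 1)"
      by (simp add: algebra_simps)
    also have "(1 - w) * gaussian w (Suc n) 1 = 1 - w ^ Suc n"
      using Suc.IH[of 0] by simp
    finally show ?thesis by (simp add: 0 algebra_simps)
  next
    case (Suc j)
    note IH = Suc.IH[of j] Suc.IH[of k]
    define a b c where "a = gaussian w n j" and "b = gaussian w n k" and "c = w ^ Suc j"
    have g: "gaussian w (Suc n) k = a + c * b"
      by (simp add: a_def b_def c_def Suc)
    \<comment> \<open>the induction hypotheses control \<open>1 - c\<close> times one entry and \<open>1 - w c\<close> times its right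
      neighbour; writing \<open>1 - w c = (1 - w) + w (1 - c)\<close> brings both into play\<close>
    have 1: "(1 - c) * (a + c * b) = (1 - w ^ Suc n) * a"
      using IH(1) by (simp add: a_def b_def c_def Suc)
    have 2: "(1 - w * c) * gaussian w (Suc n) (Suc k) = (1 - w ^ Suc n) * b"
      using IH(2) by (simp add: b_def c_def Suc)
    have "(1 - w ^ Suc k) * gaussian w (Suc (Suc n)) (Suc k) =
        (1 - w * c) * (a + c * b) + w * c * ((1 - w * c) * gaussian w (Suc n) (Suc k))"
      using g by (simp add: c_def Suc algebra_simps)
    also have "\<dots> = (1 - w * c) * (a + c * b) + w * c * ((1 - w ^ Suc n) * b)"
      by (simp only: 2)
    also have "\<dots> = (1 - w) * (a + c * b) + w * ((1 - c) * (a + c * b)) + w * c * ((1 - w ^ Suc n) * b)"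
      by (simp add: algebra_simps)
    also have "\<dots> = (1 - w) * (a + c * b) + w * ((1 - w ^ Suc n) * a) + w * c * ((1 - w ^ Suc n) * b)"
      by (simp only: 1)
    also have "\<dots> = (1 - w ^ Suc (Suc n)) * gaussian w (Suc n) k"
      by (simp only: g) (simp add: algebra_simps)
    finally show ?thesis .
  qed
qed

lemma gaussian_root_of_unity_eq_0:
  fixes w :: "'a::idom"
  assumes "w ^ d = 1" and "\<And>k. 0 < k \<Longrightarrow> k < d \<Longrightarrow> w ^ k \<noteq> 1" and "0 < k" "k < d"
  shows "gaussian w d k = 0"
proof -
  obtain n j where "d = Suc n" "k = Suc j"
    using assms(3,4) by (metis Suc_pred gr_implies_not0 not_gr_zero)
  then have "(1 - w ^ k) * gaussian w d k = 0"
    using gaussian_absorption[of w j n] assms(1) by (simp only: right_minus_eq mult_eq_0_iff) simp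
  moreover have "w ^ k \<noteq> 1"
    using assms by blast
  ultimately show ?thesis by simp
qed

text \<open>The \<open>q\<close>-Lucas theorem, by induction on the row. A step of Pascal's rule either stays
  inside a block of size \<open>d\<close> or crosses a border of it. A border is handled by the vanishing
  of the entries above the diagonal and of the inner entries of row \<open>d\<close>, a corner by the
  ordinary Pascal rule for the quotients.\<close>

lemma gaussian_lucas:
  fixes w :: "'a::idom"
  assumes "0 < d" and w: "w ^ d = 1" "\<And>k. 0 < k \<Longrightarrow> k < d \<Longrightarrow> w ^ k \<noteq> 1"
  shows "gaussian w n k = of_nat ((n div d) choose (k div d)) * gaussian w (n mod d) (k mod d)"
proof (induction n arbitrary: k)
  case 0
  show ?case
  proof (cases "k mod d")
    case 0
    then have "k = 0 \<or> 0 < k div d"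
      using \<open>0 < d\<close> by (metis div_greater_zero_iff gr0I mod_less not_less)
    then show ?thesis
      by (cases k) (auto simp: 0 binomial_eq_0)
  next
    case (Suc j)
    then show ?thesis
      by (cases k) (auto simp: gaussian_eq_0)
  qed
next
  case (Suc n)
  show ?case
  proof (cases k)
    case (Suc j)
    have per: "w ^ Suc j = w ^ (Suc j mod d)"
    proof -
      have "w ^ Suc j = w ^ (d * (Suc j div d) + Suc j mod d)"
        by simp
      then show ?thesis
        by (simp only: power_add power_mult w power_one mult_1)
    qed
    have top: "gaussian w (Suc b) (Suc c) = gaussian w b c + w ^ Suc c * gaussian w b (Suc c)" for b c
      by simp
    have eq: "gaussian w (Suc n) k =
        of_nat ((n div d) choose (j div d)) * gaussian w (n mod d) (j mod d) +
        w ^ (Suc j mod d) * (of_nat ((n div d) choose (Suc j div d)) * gaussian w (n mod d) (Suc j mod d))"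
      unfolding Suc gaussian.simps(3) per Suc.IH by (rule refl)
    have bound: "n mod d < d" "j mod d < d"
      using \<open>0 < d\<close> by simp_all
    consider (inner) "Suc (n mod d) < d" "Suc (j mod d) < d"
      | (right) "Suc (n mod d) < d" "Suc (j mod d) = d"
      | (top) "Suc (n mod d) = d" "Suc (j mod d) < d"
      | (corner) "Suc (n mod d) = d" "Suc (j mod d) = d"
      using bound by linarith
    then show ?thesis
    proof cases
      case inner
      then show ?thesis
        unfolding eq unfolding Suc by (simp add: mod_Suc div_Suc algebra_simps)
    next
      case right
      then have "gaussian w (n mod d) (j mod d) = 0"
        by (intro gaussian_eq_0) simp
      with right show ?thesis
        unfolding eq unfolding Suc by (simp add: mod_Suc div_Suc)
    next
      case top
      have "gaussian w (Suc (n mod d)) (Suc (j mod d)) = 0"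
        using top gaussian_root_of_unity_eq_0[OF w] by simp
      then have "gaussian w (n mod d) (j mod d) + w ^ Suc (j mod d) * gaussian w (n mod d) (Suc (j mod d)) = 0"
        by simp
      then have "of_nat ((n div d) choose (j div d)) * (gaussian w (n mod d) (j mod d) +
          w ^ Suc (j mod d) * gaussian w (n mod d) (Suc (j mod d))) = 0"
        by simp
      with top show ?thesis
        unfolding eq unfolding Suc by (simp add: mod_Suc div_Suc algebra_simps)
    next
      case corner
      then have "n mod d = j mod d"
        by simp
      with corner show ?thesis
        unfolding eq unfolding Suc by (simp add: mod_Suc div_Suc gaussian_self)
    qed
  qed simp
qed

text \<open>The recursion involves ring operations alone, so the Gaussian binomials commute with evaluation
  maps.\<close>

lemma gaussian_hom:
  assumes "h 0 = 0" "h 1 = 1" "\<And>u v. h (u + v) = h u + h v" "\<And>u v. h (u * v) = h u * h v"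
  shows "h (gaussian w n k) = gaussian (h w) n k"
proof -
  have "h (u ^ m) = h u ^ m" for u m
    by (induction m) (simp_all add: assms)
  then show ?thesis
    by (induction w n k rule: gaussian.induct) (simp_all add: assms del: power_Suc)
qed

section \<open>Divisibility by cyclotomic polynomials\<close>

text \<open>Division by the monic polynomial \<open>\<Phi>\<^sub>d\<close> leaves a remainder of smaller degree that
  vanishes at all primitive roots of unity; there are \<open>deg \<Phi>\<^sub>d\<close> of them, so the
  remainder is zero.\<close>

lemma cyclotomic_dvd:
  assumes "0 < d" and root: "\<And>w. w \<in> primitive_roots d \<Longrightarrow> poly (map_poly of_int p) w = 0"
  shows "cyclotomic d dvd p"
proof -
  let ?c = "map_poly of_int :: int poly \<Rightarrow> complex poly"
  have hom: "?c (r * s) = ?c r * ?c s" "?c (r + s) = ?c r + ?c s" for r s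
    by (simp_all add: poly_eq_iff Polynomial.coeff_mult coeff_map_poly)
  have deg: "Polynomial.degree (cyclotomic d) = card (primitive_roots d)"
  proof -
    have "Polynomial.degree (cyclotomic d) = Polynomial.degree (?c (cyclotomic d))"
      by (simp add: degree_map_poly)
    also have "\<dots> = card (primitive_roots d)"
      unfolding of_int_poly_cyclotomic[OF \<open>0 < d\<close>] by (simp add: degree_prod_eq_sum_degree)
    finally show ?thesis .
  qed
  have lc: "lead_coeff (cyclotomic d) = 1"
  proof -
    have "of_int (lead_coeff (cyclotomic d)) = lead_coeff (?c (cyclotomic d))"
      by (simp add: degree_map_poly coeff_map_poly)
    also have "\<dots> = 1"
      unfolding of_int_poly_cyclotomic[OF \<open>0 < d\<close>] by (simp add: lead_coeff_prod)
    finally show ?thesis by simp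
  qed
  then have "cyclotomic d \<noteq> 0" by auto
  obtain Q R where QR: "pseudo_divmod p (cyclotomic d) = (Q, R)"
    by (cases "pseudo_divmod p (cyclotomic d)")
  from pseudo_divmod[OF \<open>cyclotomic d \<noteq> 0\<close> QR] lc
  have div: "p = cyclotomic d * Q + R"
    and R: "R = 0 \<or> Polynomial.degree R < Polynomial.degree (cyclotomic d)" by auto
  have "R = 0"
  proof (rule ccontr)
    assume "R \<noteq> 0"
    then have "?c R \<noteq> 0" by (simp add: poly_eq_iff coeff_map_poly)
    have "poly (?c R) w = 0" if "w \<in> primitive_roots d" for w
    proof -
      have "poly (?c (cyclotomic d)) w = 0"
        unfolding of_int_poly_cyclotomic[OF \<open>0 < d\<close>]
        using that finite_primitive_roots[OF \<open>0 < d\<close>] by (auto simp: poly_prod)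
      then show ?thesis
        using root[OF that] by (simp add: div hom)
    qed
    then have "card (primitive_roots d) \<le> card {w. poly (?c R) w = 0}"
      by (intro card_mono poly_roots_finite[OF \<open>?c R \<noteq> 0\<close>]) auto
    also have "\<dots> \<le> Polynomial.degree (?c R)"
      by (rule card_poly_roots_bound[OF \<open>?c R \<noteq> 0\<close>])
    finally show False
      using R \<open>R \<noteq> 0\<close> by (simp add: deg degree_map_poly)
  qed
  with div show ?thesis by simp
qed

lemma cyclotomic_neq_0:
  assumes "0 < d"
  shows "cyclotomic d \<noteq> 0"
proof
  assume "cyclotomic d = 0"
  then have "(\<Prod>w\<in>primitive_roots d. [:-w, 1:]) = 0"
    using of_int_poly_cyclotomic[OF assms] by simp
  then show False
    using finite_primitive_roots[OF assms] by simp
qed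

section \<open>Laurent polynomials in q\<close>

lemma poly_in_q_simps:
  "poly_in_q 0 = 0" "poly_in_q 1 = 1" "poly_in_q (p + r) = poly_in_q p + poly_in_q r"
  "poly_in_q (p - r) = poly_in_q p - poly_in_q r"
  "poly_in_q (p * r) = poly_in_q p * poly_in_q r"
proof -
  have "map_poly of_int (p * r) = map_poly of_int p * (map_poly of_int r :: rat poly)"
    "map_poly of_int (p + r) = map_poly of_int p + (map_poly of_int r :: rat poly)"
    "map_poly of_int (p - r) = map_poly of_int p - (map_poly of_int r :: rat poly)"
    by (simp_all add: poly_eq_iff Polynomial.coeff_mult coeff_map_poly)
  then show "poly_in_q (p + r) = poly_in_q p + poly_in_q r"
    "poly_in_q (p - r) = poly_in_q p - poly_in_q r"
    "poly_in_q (p * r) = poly_in_q p * poly_in_q r"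
    by (simp_all add: poly_in_q_def)
qed (simp_all add: poly_in_q_def)

lemma poly_in_q_eq_iff: "poly_in_q p = poly_in_q r \<longleftrightarrow> p = r"
  by (simp add: poly_in_q_def poly_eq_iff coeff_map_poly)

lemma poly_in_q_X: "poly_in_q [:0, 1:] = q_indet"
proof -
  have "map_poly of_int [:0, 1:] = ([:0, 1:] :: rat poly)"
    by (rule poly_eqI) (simp add: coeff_map_poly coeff_pCons split: nat.split)
  then show ?thesis by (simp add: poly_in_q_def q_indet_def)
qed

lemma poly_in_q_monom: "poly_in_q (Polynomial.monom 1 n) = q_indet ^ n"
proof (induction n)
  case 0
  then show ?case by (simp add: poly_in_q_simps flip: one_poly_eq_simps(2))
next
  case (Suc n)
  have "(Polynomial.monom 1 (Suc n) :: int poly) = [:0, 1:] * Polynomial.monom 1 n"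
    by (simp add: monom_Suc)
  then show ?case
    using Suc by (simp only: poly_in_q_simps poly_in_q_X power_Suc)
qed

lemma q_indet_neq_0: "q_indet \<noteq> 0"
  by (simp add: q_indet_def)

lemma q_indet_power_neq_1:
  assumes "0 < n"
  shows "q_indet ^ n \<noteq> 1"
proof
  assume "q_indet ^ n = 1"
  then have "poly_in_q (Polynomial.monom 1 n) = poly_in_q 1"
    by (simp add: poly_in_q_monom poly_in_q_simps)
  then have "Polynomial.degree (Polynomial.monom (1::int) n) = 0"
    by (simp add: poly_in_q_eq_iff)
  with assms show False
    by (simp add: degree_monom_eq)
qed

lemma carrier_laurent_ring: "carrier laurent_ring = {poly_in_q p / q_indet ^ n | p n. True}"
  by (simp add: laurent_ring_def)

lemma laurentI: "poly_in_q p / q_indet ^ n \<in> carrier laurent_ring"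
  by (auto simp: carrier_laurent_ring)

lemma poly_in_q_closed: "poly_in_q p \<in> carrier laurent_ring"
  using laurentI[of p 0] by simp

interpretation laurent: subring_of_type "carrier laurent_ring"
  rewrites "ring_of_type_algebra\<lparr>carrier := carrier laurent_ring\<rparr> = laurent_ring"
proof unfold_locales
  fix x y assume "x \<in> carrier laurent_ring" "y \<in> carrier laurent_ring"
  then obtain p m r n where x: "x = poly_in_q p / q_indet ^ m" and y: "y = poly_in_q r / q_indet ^ n"
    by (auto simp: carrier_laurent_ring)
  have "x - y = poly_in_q (p * Polynomial.monom 1 n - r * Polynomial.monom 1 m) / q_indet ^ (m + n)"
    by (simp add: x y poly_in_q_simps poly_in_q_monom q_indet_neq_0 divide_simps power_add algebra_simps)
  then show "x - y \<in> carrier laurent_ring"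
    using laurentI by metis
  have "x * y = poly_in_q (p * r) / q_indet ^ (m + n)"
    by (simp add: x y poly_in_q_simps power_add)
  then show "x * y \<in> carrier laurent_ring"
    using laurentI by metis
qed (use poly_in_q_closed[of 1] in \<open>simp_all add: poly_in_q_simps laurent_ring_def\<close>)

lemma q_indet_closed: "q_indet \<in> carrier laurent_ring"
  using poly_in_q_closed[of "[:0, 1:]"] by (simp add: poly_in_q_X)

lemma inverse_q_indet_closed: "inverse q_indet \<in> carrier laurent_ring"
  using laurentI[of 1 1] by (simp add: poly_in_q_simps field_simps)

abbreviation const_q :: "rat \<Rightarrow> qrat" where
  "const_q a \<equiv> to_fract [:a:]"

lemma const_q_simps:
  "const_q (a + b) = const_q a + const_q b" "const_q (a * b) = const_q a * const_q b"
  "const_q (sum h I) = (\<Sum>i\<in>I. const_q (h i))"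
proof -
  show add: "const_q (a + b) = const_q a + const_q b" for a b
    by (simp flip: to_fract_add)
  show "const_q (a * b) = const_q a * const_q b"
    by (simp flip: to_fract_mult)
  show "const_q (sum h I) = (\<Sum>i\<in>I. const_q (h i))"
    by (induction I rule: infinite_finite_induct) (simp_all add: add)
qed

lemma const_q_of_int: "const_q (of_int i) = poly_in_q [:i:]"
  by (simp add: poly_in_q_def map_poly_pCons)

lemma const_q_closed: "a \<in> \<int> \<Longrightarrow> const_q a \<in> carrier laurent_ring"
  by (auto elim!: Ints_cases simp: const_q_of_int poly_in_q_closed)

section \<open>Values of the quantum binomials\<close>

lemma qint_0: "qint 0 = 0"
  by (simp add: qint_def)

lemma qint_neq_0: "0 < n \<Longrightarrow> qint (int n) \<noteq> 0"
  using q_indet_power_neq_1[of n] q_indet_power_neq_1[of 1] by (simp add: qint_def)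

lemma qint_add: "qint (m + n) = qint m + q_indet powi m * qint n"
  using q_indet_power_neq_1[of 1] q_indet_neq_0
  by (simp add: qint_def power_int_add diff_divide_distrib algebra_simps)

lemma qfact_Suc: "qfact (Suc k) = qfact k * qint (int (Suc k))"
  by (simp add: qfact_def)

lemma qfact_neq_0: "qfact k \<noteq> 0"
proof (induction k)
  case 0
  then show ?case by (simp add: qfact_def)
next
  case (Suc k)
  then show ?case
    using qint_neq_0[of "Suc k"] by (simp only: qfact_Suc mult_eq_0_iff) simp
qed

lemma poly_qbinom_poly: "poly (qbinom_poly k) (qint n) = (\<Prod>i<k. qint (n - int i)) / qfact k"
proof -
  have "(\<Prod>i<k. qint n - qint (int i)) = q_indet ^ (k choose 2) * (\<Prod>i<k. qint (n - int i))"
  proof (induction k)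
    case (Suc k)
    have "qint n - qint (int k) = q_indet ^ k * qint (n - int k)"
      using qint_add[of "int k" "n - int k"] by simp
    moreover have "Suc k choose 2 = (k choose 2) + k"
      by (simp add: numeral_2_eq_2)
    ultimately show ?case
      by (simp add: Suc power_add)
  qed (simp add: binomial_eq_0)
  then show ?thesis
    by (simp add: qbinom_poly_def poly_prod q_indet_neq_0)
qed

text \<open>For all integers \<open>n\<close>; this is what makes the negative \<open>n\<close> in the definition of
  quantum integer-valued polynomials accessible. It reduces to
  \<open>[n + 1]\<^sub>q = [k + 1]\<^sub>q + q ^ (k + 1) [n - k]\<^sub>q\<close>.\<close>

lemma qbinom_pascal:
  "poly (qbinom_poly (Suc k)) (qint (n + 1)) =
    poly (qbinom_poly k) (qint n) + q_indet ^ Suc k * poly (qbinom_poly (Suc k)) (qint n)"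
proof -
  define A where "A = (\<Prod>i<k. qint (n - int i))"
  have 1: "(\<Prod>i<Suc k. qint (n + 1 - int i)) = qint (n + 1) * A"
    unfolding A_def prod.lessThan_Suc_shift by (simp add: algebra_simps)
  have 2: "(\<Prod>i<Suc k. qint (n - int i)) = A * qint (n - int k)"
    by (simp add: A_def)
  have 3: "qint (n + 1) = qint (int (Suc k)) + q_indet ^ Suc k * qint (n - int k)"
  proof -
    have "n + 1 = int (Suc k) + (n - int k)" by simp
    then show ?thesis
      by (metis qint_add power_int_of_nat)
  qed
  have nz: "qfact k \<noteq> 0" "qint (int (Suc k)) \<noteq> 0"
    using qfact_neq_0 qint_neq_0[of "Suc k"] by auto
  show ?thesis
    unfolding poly_qbinom_poly 1 2 qfact_Suc unfolding 3 A_def[symmetric] using nz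
    by (simp add: field_simps del: of_nat_Suc)
qed

lemma qbinom_poly_0: "qbinom_poly 0 = 1"
  by (simp add: qbinom_poly_def qfact_def binomial_eq_0 one_pCons)

lemma qbinom_eq_0: "n < k \<Longrightarrow> poly (qbinom_poly k) (qint (int n)) = 0"
  by (auto simp: poly_qbinom_poly qint_0 intro!: bexI[of _ n])

lemma qbinom_eq_gaussian: "poly (qbinom_poly k) (qint (int n)) = gaussian q_indet n k"
proof (induction n arbitrary: k)
  case 0
  then show ?case
    using qbinom_eq_0[of 0 k] by (cases k) (simp_all add: qbinom_poly_0)
next
  case (Suc n)
  then show ?case
    using qbinom_pascal[of _ "int n"] by (cases k) (simp_all add: qbinom_poly_0 add.commute)
qed

text \<open>Pascal's rule can be read upwards and downwards in \<open>n\<close>, starting from \<open>n = 0\<close>; the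
  downward reading divides by a power of \<open>q\<close>, which is a unit.\<close>

lemma qbinom_closed: "poly (qbinom_poly k) (qint n) \<in> carrier laurent_ring"
proof (induction k arbitrary: n)
  case 0
  then show ?case by (simp add: qbinom_poly_0 laurent.one_closed)
next
  case (Suc k)
  note IH = Suc
  show ?case
  proof (induction n rule: int_induct[where k = 0])
    case base
    then show ?case
      using qbinom_eq_0[of 0 "Suc k"] by (simp add: laurent.zero_closed)
  next
    case (step1 n)
    then show ?case
      unfolding qbinom_pascal
      by (intro laurent.add_closed laurent.mult_closed laurent.power_closed IH q_indet_closed)
  next
    case (step2 n)
    have "poly (qbinom_poly (Suc k)) (qint (n - 1)) = inverse q_indet ^ Suc k *
        (poly (qbinom_poly (Suc k)) (qint n) - poly (qbinom_poly k) (qint (n - 1)))"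
      using qbinom_pascal[of k "n - 1"] q_indet_neq_0 by (simp add: field_simps)
    also have "\<dots> \<in> carrier laurent_ring"
      by (intro laurent.diff_closed laurent.mult_closed laurent.power_closed IH
          inverse_q_indet_closed step2.IH)
    finally show ?case .
  qed
qed

interpretation qnewton: newton_basis "carrier laurent_ring" "\<lambda>n. qint (int n)" qbinom_poly
proof
  fix n k :: nat
  show "Polynomial.degree (qbinom_poly k) \<le> k"
    unfolding qbinom_poly_def
    by (rule order_trans[OF Polynomial.degree_smult_le]) (simp add: Polynomial.degree_prod_eq_sum_degree)
qed (simp_all add: qbinom_closed qbinom_eq_0, simp add: qbinom_eq_gaussian gaussian_self)

lemma poly_in_q_gaussian: "poly_in_q (gaussian [:0, 1:] n k) = gaussian q_indet n k"
  using gaussian_hom[of poly_in_q] by (simp add: poly_in_q_simps poly_in_q_X)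

lemma poly_of_int_gaussian:
  "poly (map_poly of_int (gaussian [:0, 1:] n k)) (w::complex) = gaussian w n k"
proof -
  define ev where "ev = (\<lambda>p::int poly. poly (map_poly of_int p) w)"
  have "map_poly of_int (r * s) = (map_poly of_int r * map_poly of_int s :: complex poly)"
     "map_poly of_int (r + s) = (map_poly of_int r + map_poly of_int s :: complex poly)" for r s
    by (simp_all add: poly_eq_iff Polynomial.coeff_mult coeff_map_poly)
  then have hom: "ev (r * s) = ev r * ev s" "ev (r + s) = ev r + ev s" "ev 1 = 1" "ev 0 = 0"
     "ev [:0, 1:] = w" for r s
    by (simp_all add: ev_def map_poly_pCons)
  then have "ev (gaussian [:0, 1:] n k) = gaussian w n k"
    using gaussian_hom[of ev "[:0, 1:]" n k] by (simp only:)
  then show ?thesis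
    by (simp add: ev_def)
qed

section \<open>Tensor products over the integers\<close>

text \<open>Group properties do not see the extension part of a record; the additive groups below are
  reached from records with different extensions.\<close>

lemma comm_group_cong:
  fixes G :: "('a, 'm) monoid_scheme" and H :: "('a, 'n) monoid_scheme"
  assumes "comm_group G" "carrier H = carrier G" "monoid.mult H = monoid.mult G" "\<one>\<^bsub>H\<^esub> = \<one>\<^bsub>G\<^esub>"
  shows "comm_group H"
proof -
  interpret G: comm_group G by fact
  show ?thesis
    by (rule comm_groupI) (use assms G.m_assoc G.m_comm G.l_inv_ex in auto)
qed

text \<open>The additive group and the scalar action of \<open>R \<otimes> A\<close>, described through classes
  of representatives in the free Abelian group.\<close>

locale tensor = R: abelian_group R + A: cring A
  for R :: "('r, 'm) ring_scheme" and A :: "('a, 'n) ring_scheme"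
begin

abbreviation "Pairs \<equiv> carrier R \<times> carrier A"
abbreviation "F \<equiv> tensor_free R A"
abbreviation "Rel \<equiv> tensor_relations R A"
abbreviation "T \<equiv> scalar_ext R A"
abbreviation "tc \<equiv> tensor_class R A"
abbreviation "scale a \<equiv> frag_extend (\<lambda>(r, b). frag_of (r, a \<otimes>\<^bsub>A\<^esub> b))"

lemma comm_group_free: "comm_group F"
  unfolding tensor_free_def by (rule abelian_free_Abelian_group)

sublocale F: comm_group F
  by (rule comm_group_free)

lemma free_simps:
  "c \<in> carrier F \<longleftrightarrow> Poly_Mapping.keys c \<subseteq> Pairs" "c \<otimes>\<^bsub>F\<^esub> e = c + e" "\<one>\<^bsub>F\<^esub> = 0"
  by (auto simp: tensor_free_def)

lemma free_inv: "c \<in> carrier F \<Longrightarrow> inv\<^bsub>F\<^esub> c = - c"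
  by (auto simp: tensor_free_def)

lemma free_closed:
  "0 \<in> carrier F" "c \<in> carrier F \<Longrightarrow> e \<in> carrier F \<Longrightarrow> c + e \<in> carrier F"
  "c \<in> carrier F \<Longrightarrow> - c \<in> carrier F"
  "c \<in> carrier F \<Longrightarrow> e \<in> carrier F \<Longrightarrow> c - e \<in> carrier F"
  "r \<in> carrier R \<Longrightarrow> a \<in> carrier A \<Longrightarrow> frag_of (r, a) \<in> carrier F"
proof -
  show m: "- c \<in> carrier F" if "c \<in> carrier F" for c
    using that by (simp add: free_simps)
  show p: "c + e \<in> carrier F" if "c \<in> carrier F" "e \<in> carrier F" for c e
    using F.m_closed[OF that] by (simp add: free_simps(2))
  show "c - e \<in> carrier F" if "c \<in> carrier F" "e \<in> carrier F" for c e
    using p[OF that(1) m[OF that(2)]] by simp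
qed (simp_all add: free_simps)

definition gens :: "('r \<times> 'a \<Rightarrow>\<^sub>0 int) set" where
  "gens = {frag_of (r \<oplus>\<^bsub>R\<^esub> s, a) - frag_of (r, a) - frag_of (s, a) | r s a.
         r \<in> carrier R \<and> s \<in> carrier R \<and> a \<in> carrier A} \<union>
      {frag_of (r, a \<oplus>\<^bsub>A\<^esub> b) - frag_of (r, a) - frag_of (r, b) | r a b.
         r \<in> carrier R \<and> a \<in> carrier A \<and> b \<in> carrier A}"

lemma Rel_eq: "Rel = generate F gens"
  by (simp add: tensor_relations_def gens_def)

lemma gens_closed: "gens \<subseteq> carrier F"
  by (auto simp: gens_def intro!: free_closed R.a_closed A.a_closed)

lemma subgroup_Rel: "subgroup Rel F"
  unfolding Rel_eq by (rule F.generate_is_subgroup[OF gens_closed])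

lemma normal_Rel: "Rel \<lhd> F"
  using subgroup_Rel by (rule F.subgroup_imp_normal)

interpretation Rel: normal Rel F
  by (rule normal_Rel)

lemma Rel_closed:
  "0 \<in> Rel" "c \<in> Rel \<Longrightarrow> e \<in> Rel \<Longrightarrow> c + e \<in> Rel" "c \<in> Rel \<Longrightarrow> - c \<in> Rel"
  "c \<in> Rel \<Longrightarrow> c \<in> carrier F"
  using Rel.one_closed Rel.m_closed[of c e] Rel.m_inv_closed[of c] Rel.mem_carrier[of c]
  by (auto simp: free_simps(2,3) free_inv)

lemma Rel_sum: "(\<And>i. i \<in> I \<Longrightarrow> f i \<in> Rel) \<Longrightarrow> sum f I \<in> Rel"
  by (induction I rule: infinite_finite_induct) (auto intro: Rel_closed)

lemma Rel_left:
  "r \<in> carrier R \<Longrightarrow> s \<in> carrier R \<Longrightarrow> a \<in> carrier A \<Longrightarrow>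
    frag_of (r \<oplus>\<^bsub>R\<^esub> s, a) - frag_of (r, a) - frag_of (s, a) \<in> Rel"
  unfolding Rel_eq by (rule generate.incl) (auto simp: gens_def)

lemma Rel_right:
  "r \<in> carrier R \<Longrightarrow> a \<in> carrier A \<Longrightarrow> b \<in> carrier A \<Longrightarrow>
    frag_of (r, a \<oplus>\<^bsub>A\<^esub> b) - frag_of (r, a) - frag_of (r, b) \<in> Rel"
  unfolding Rel_eq by (rule generate.incl) (auto simp: gens_def)

lemma Rel_zero:
  assumes "r \<in> carrier R"
  shows "frag_of (r, \<zero>\<^bsub>A\<^esub>) \<in> Rel"
  using Rel_closed(3)[OF Rel_right[OF assms A.zero_closed A.zero_closed]] by simp

lemma tc_self: "c \<in> carrier F \<Longrightarrow> c \<in> tc c"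
  using F.rcos_self[OF _ subgroup_Rel] .

lemma tc_eq_iff:
  assumes "c \<in> carrier F" "e \<in> carrier F"
  shows "tc c = tc e \<longleftrightarrow> c - e \<in> Rel"
proof -
  have "tc c = tc e \<longleftrightarrow> c \<in> tc e"
    using F.repr_independence[OF _ assms(2) subgroup_Rel] tc_self[OF assms(1)] by metis
  also have "\<dots> \<longleftrightarrow> c - e \<in> Rel"
    by (force simp: r_coset_def free_simps(2))
  finally show ?thesis .
qed

lemma in_tcD:
  assumes "e \<in> tc c" "c \<in> carrier F"
  shows "e \<in> carrier F" "tc e = tc c"
proof -
  obtain r where r: "r \<in> Rel" "e = r + c"
    using assms(1) by (auto simp: r_coset_def free_simps(2))
  then show "e \<in> carrier F"
    using assms(2) by (simp add: Rel_closed free_closed)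
  then show "tc e = tc c"
    using assms(2) r by (simp add: tc_eq_iff)
qed

lemma add_monoid_T:
  "carrier T = carrier (F Mod Rel)" "add T = monoid.mult (F Mod Rel)" "\<zero>\<^bsub>T\<^esub> = \<one>\<^bsub>F Mod Rel\<^esub>"
  by (simp_all add: scalar_ext_def)

lemma comm_group_T: "comm_group (add_monoid T)"
  by (rule comm_group_cong[OF F.abelian_FactGroup[OF subgroup_Rel]]) (simp_all only: add_monoid_T monoid.simps partial_object.simps)

lemma hom_T: "hom (add_monoid T) G = hom (F Mod Rel) G"
  unfolding hom_def by (simp only: add_monoid_T monoid.simps partial_object.simps)

lemma T_simps:
  "carrier T = tc ` carrier F"
  "c \<in> carrier F \<Longrightarrow> e \<in> carrier F \<Longrightarrow> tc c \<oplus>\<^bsub>T\<^esub> tc e = tc (c + e)"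
  "\<zero>\<^bsub>T\<^esub> = tc 0"
  using Rel.rcos_sum[of c e] F.coset_mult_one[of Rel] Rel.subset
  by (auto simp: scalar_ext_def FactGroup_def RCOSETS_def free_simps(2,3))

text \<open>Pure tensors generate the tensor product as a group.\<close>

lemma T_hom_eqI:
  assumes "group G" "f \<in> hom (add_monoid T) G" "g \<in> hom (add_monoid T) G"
    and eq: "\<And>r a. r \<in> carrier R \<Longrightarrow> a \<in> carrier A \<Longrightarrow> f (pure_tensor R A r a) = g (pure_tensor R A r a)"
    and "t \<in> carrier T"
  shows "f t = g t"
proof -
  interpret T: comm_group "add_monoid T" by (rule comm_group_T)
  interpret f: group_hom "add_monoid T" G f
    using assms by (simp add: group_hom_def group_hom_axioms_def)
  interpret g: group_hom "add_monoid T" G g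
    using assms by (simp add: group_hom_def group_hom_axioms_def)
  have tc_diff: "tc (c - e) = tc c \<otimes>\<^bsub>add_monoid T\<^esub> inv\<^bsub>add_monoid T\<^esub> tc e"
    if "c \<in> carrier F" "e \<in> carrier F" for c e
  proof -
    have "tc (c - e) \<otimes>\<^bsub>add_monoid T\<^esub> tc e = tc c"
      using that free_closed(4) by (simp add: T_simps)
    then show ?thesis
      using that free_closed(4) T.inv_solve_right[of "tc (c - e)" "tc c" "tc e"]
      by (simp add: T_simps)
  qed
  obtain c where c: "c \<in> carrier F" "t = tc c"
    using assms(5) by (auto simp: T_simps)
  have "Poly_Mapping.keys c \<subseteq> Pairs"
    using c by (simp add: free_simps)
  then have "f (tc c) = g (tc c)"
  proof (induction c rule: free_Abelian_group_induct[consumes 1, case_names zero diff one])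
    case zero
    then show ?case
      using f.hom_one g.hom_one by (simp add: T_simps)
  next
    case (diff x y)
    then have "x \<in> carrier F" "y \<in> carrier F"
      by (auto simp: free_simps)
    then have "tc x \<in> carrier (add_monoid T)" "tc y \<in> carrier (add_monoid T)"
      by (simp_all add: T_simps)
    then show ?case
      unfolding tc_diff[OF \<open>x \<in> carrier F\<close> \<open>y \<in> carrier F\<close>]
      using diff.IH by (simp only: f.hom_mult g.hom_mult f.hom_inv g.hom_inv T.inv_closed)
  next
    case (one a)
    then show ?case
      using eq[of "fst a" "snd a"] by (auto simp: pure_tensor_def)
  qed
  then show ?thesis
    by (simp add: c)
qed

text \<open>The universal property: a biadditive map extends to the free Abelian group on pairs, and the
  extension kills the generators of the relations.\<close>

lemma universal:
  assumes "comm_group G"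
    and closed: "\<And>r a. r \<in> carrier R \<Longrightarrow> a \<in> carrier A \<Longrightarrow> \<beta> r a \<in> carrier G"
    and left: "\<And>r s a. r \<in> carrier R \<Longrightarrow> s \<in> carrier R \<Longrightarrow> a \<in> carrier A \<Longrightarrow>
      \<beta> (r \<oplus>\<^bsub>R\<^esub> s) a = \<beta> r a \<otimes>\<^bsub>G\<^esub> \<beta> s a"
    and right: "\<And>r a b. r \<in> carrier R \<Longrightarrow> a \<in> carrier A \<Longrightarrow> b \<in> carrier A \<Longrightarrow>
      \<beta> r (a \<oplus>\<^bsub>A\<^esub> b) = \<beta> r a \<otimes>\<^bsub>G\<^esub> \<beta> r b"
  obtains g where "g \<in> hom (add_monoid T) G"
    "\<And>r a. r \<in> carrier R \<Longrightarrow> a \<in> carrier A \<Longrightarrow> g (pure_tensor R A r a) = \<beta> r a"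
proof -
  interpret G: comm_group G by fact
  have "(\<lambda>(r, a). \<beta> r a) ` Pairs \<subseteq> carrier G"
    using closed by auto
  from G.free_Abelian_group_universal[OF this] obtain H where
    H: "H \<in> hom F G" "\<And>x. x \<in> Pairs \<Longrightarrow> H (frag_of x) = (case x of (r, a) \<Rightarrow> \<beta> r a)"
    unfolding tensor_free_def by blast
  interpret H: group_hom F G H
    using H(1) by (simp add: group_hom_def group_hom_axioms_def F.group_axioms G.group_axioms)
  have H_diff: "H (c - e) = H c \<otimes>\<^bsub>G\<^esub> inv\<^bsub>G\<^esub> H e" if "c \<in> carrier F" "e \<in> carrier F" for c e
    using that H.hom_mult[of c "- e"] H.hom_inv[of e] by (simp add: free_simps(2) free_inv free_closed)
  have cancel: "u \<otimes>\<^bsub>G\<^esub> v \<otimes>\<^bsub>G\<^esub> inv\<^bsub>G\<^esub> u \<otimes>\<^bsub>G\<^esub> inv\<^bsub>G\<^esub> v = \<one>\<^bsub>G\<^esub>"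
    if "u \<in> carrier G" "v \<in> carrier G" for u v
    using that by (simp add: G.m_comm[of u v] G.m_assoc)
  have H_of: "H (frag_of (r, a)) = \<beta> r a" if "r \<in> carrier R" "a \<in> carrier A" for r a
    using H(2)[of "(r, a)"] that by simp
  have H_gen: "H (c - e - e') = \<one>\<^bsub>G\<^esub>"
    if "c \<in> carrier F" "e \<in> carrier F" "e' \<in> carrier F" "H c = H e \<otimes>\<^bsub>G\<^esub> H e'" for c e e'
    using that by (simp add: H_diff free_closed cancel)
  have "H c = \<one>\<^bsub>G\<^esub>" if "c \<in> gens" for c
    using that unfolding gens_def
  proof (elim UnE CollectE exE conjE)
    fix r s a assume *: "c = frag_of (r \<oplus>\<^bsub>R\<^esub> s, a) - frag_of (r, a) - frag_of (s, a)"
      "r \<in> carrier R" "s \<in> carrier R" "a \<in> carrier A"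
    show ?thesis
      unfolding *(1) by (rule H_gen) (use * in \<open>simp_all add: H_of left free_closed\<close>)
  next
    fix r a b assume *: "c = frag_of (r, a \<oplus>\<^bsub>A\<^esub> b) - frag_of (r, a) - frag_of (r, b)"
      "r \<in> carrier R" "a \<in> carrier A" "b \<in> carrier A"
    show ?thesis
      unfolding *(1) by (rule H_gen) (use * in \<open>simp_all add: H_of right free_closed\<close>)
  qed
  then have "gens \<subseteq> kernel F G H"
    using gens_closed by (auto simp: kernel_def)
  then have ker: "Rel \<subseteq> kernel F G H"
    unfolding Rel_eq by (rule F.generate_subgroup_incl[OF _ H.subgroup_kernel])
  obtain g where g: "g \<in> hom (F Mod Rel) G" "\<And>c. c \<in> carrier F \<Longrightarrow> g (tc c) = H c"
  proof (rule FactGroup_universal[OF H(1) normal_Rel])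
    fix c e assume ce: "c \<in> carrier F" "e \<in> carrier F" "tc c = tc e"
    then have "H (c - e) = \<one>\<^bsub>G\<^esub>"
      using ker by (auto simp: tc_eq_iff kernel_def)
    then show "H c = H e"
      using ce by (simp add: H_diff G.inv_solve_right')
  qed blast
  show thesis
    by (rule that[of g]) (use g in \<open>auto simp: hom_T pure_tensor_def free_closed H_of\<close>)
qed

lemma scale_closed:
  assumes "a \<in> carrier A" "c \<in> carrier F"
  shows "scale a c \<in> carrier F"
  using assms keys_frag_extend[of "\<lambda>(r, b). frag_of (r, a \<otimes>\<^bsub>A\<^esub> b)" c]
  by (fastforce simp: free_simps)

lemma scale_gens:
  assumes "a \<in> carrier A" "c \<in> gens"
  shows "scale a c \<in> Rel"
  using assms unfolding gens_def
  by (auto simp: frag_extend_diff A.r_distr A.m_closed intro!: Rel_left Rel_right)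

lemma scale_Rel:
  assumes a: "a \<in> carrier A" and "c \<in> Rel"
  shows "scale a c \<in> Rel"
  using assms(2) unfolding Rel_eq
proof (induction c rule: generate.induct)
  case one
  then show ?case
    by (simp add: free_simps(3) generate.one[of F, unfolded free_simps(3)])
next
  case (incl c)
  then show ?case
    using scale_gens[OF a] by (simp only: Rel_eq)
next
  case (inv c)
  then have "scale a c \<in> Rel"
    using scale_gens[OF a] by blast
  moreover have "c \<in> carrier F"
    using inv gens_closed by blast
  ultimately show ?case
    unfolding Rel_eq[symmetric] by (simp add: free_inv frag_extend_minus Rel_closed)
next
  case (eng c e)
  then show ?case
    unfolding Rel_eq[symmetric] by (simp add: free_simps(2) frag_extend_add Rel_closed)
qed

lemma smult_tc:
  assumes "a \<in> carrier A" "c \<in> carrier F"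
  shows "a \<odot>\<^bsub>T\<^esub> tc c = tc (scale a c)"
proof -
  have const: "tc (scale a e) = tc (scale a c)" if "e \<in> tc c" for e
  proof -
    have e: "e \<in> carrier F" "e - c \<in> Rel"
      using in_tcD[OF that assms(2)] tc_eq_iff assms(2) by auto
    then show ?thesis
      using scale_Rel[OF assms(1) e(2)] by (simp add: tc_eq_iff scale_closed assms frag_extend_diff)
  qed
  have "a \<odot>\<^bsub>T\<^esub> tc c = (\<Union>e\<in>tc c. tc (scale a e))"
    by (simp add: scalar_ext_def)
  also have "\<dots> = tc (scale a c)"
    using tc_self[OF assms(2)] const by blast
  finally show ?thesis .
qed

lemma smult_T_hom:
  assumes "a \<in> carrier A"
  shows "(\<lambda>t. a \<odot>\<^bsub>T\<^esub> t) \<in> hom (add_monoid T) (add_monoid T)"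
  by (rule homI)
    (auto simp: T_simps smult_tc scale_closed assms free_closed frag_extend_add)

lemma pure_tensor_closed:
  "r \<in> carrier R \<Longrightarrow> a \<in> carrier A \<Longrightarrow> pure_tensor R A r a \<in> carrier T"
  by (simp add: T_simps pure_tensor_def free_closed)

lemma smult_pure_tensor:
  assumes "r \<in> carrier R" "a \<in> carrier A" "b \<in> carrier A"
  shows "a \<odot>\<^bsub>T\<^esub> pure_tensor R A r b = pure_tensor R A r (a \<otimes>\<^bsub>A\<^esub> b)"
  using assms by (simp add: pure_tensor_def smult_tc free_closed)

lemma pure_tensor_add_left:
  assumes "r \<in> carrier R" "s \<in> carrier R" "a \<in> carrier A"
  shows "pure_tensor R A (r \<oplus>\<^bsub>R\<^esub> s) a = pure_tensor R A r a \<oplus>\<^bsub>T\<^esub> pure_tensor R A s a"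
  using assms Rel_left[OF assms]
  by (simp add: pure_tensor_def T_simps tc_eq_iff free_closed R.a_closed algebra_simps)

end

section \<open>The two rings of integer-valued polynomials\<close>

lemma carrier_int_valued_polys: "carrier int_valued_polys = {P. \<forall>n::nat. poly P (of_nat n) \<in> \<int>}"
  by (simp add: int_valued_polys_def)

lemma carrier_q_int_valued_polys:
  "carrier q_int_valued_polys = {P. \<forall>n::int. poly P (qint n) \<in> carrier laurent_ring}"
  by (simp add: q_int_valued_polys_def)

interpretation ivp: subring_of_type "carrier int_valued_polys"
  rewrites "ring_of_type_algebra\<lparr>carrier := carrier int_valued_polys\<rparr> = int_valued_polys"
  by unfold_locales (auto simp: carrier_int_valued_polys, simp add: int_valued_polys_def)

interpretation qivp: subring_of_type "carrier q_int_valued_polys"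
  rewrites "ring_of_type_algebra\<lparr>carrier := carrier q_int_valued_polys\<rparr> = q_int_valued_polys"
  by unfold_locales
    (auto simp: carrier_q_int_valued_polys intro: laurent.one_closed laurent.diff_closed laurent.mult_closed,
      simp add: q_int_valued_polys_def)

lemma ivp_simps:
  "P \<otimes>\<^bsub>int_valued_polys\<^esub> Q = P * Q" "P \<oplus>\<^bsub>int_valued_polys\<^esub> Q = P + Q"
  "\<one>\<^bsub>int_valued_polys\<^esub> = 1" "\<zero>\<^bsub>int_valued_polys\<^esub> = 0"
  by (simp_all add: int_valued_polys_def ring_of_type_algebra_def)

lemma binom_poly_closed: "binom_poly k \<in> carrier int_valued_polys"
  by (simp add: carrier_int_valued_polys poly_binom_poly)

lemma qbinom_poly_closed: "qbinom_poly k \<in> carrier q_int_valued_polys"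
  by (simp add: carrier_q_int_valued_polys qbinom_closed)

text \<open>The binomials generate the additive group: homomorphisms that agree on a basis agree on its
  integer multiples, by induction in both directions from zero.\<close>

lemma ivp_hom_eqI:
  assumes "group G" and f: "f \<in> hom (add_monoid int_valued_polys) G"
    and g: "g \<in> hom (add_monoid int_valued_polys) G"
    and eq: "\<And>k. f (binom_poly k) = g (binom_poly k)"
    and "P \<in> carrier int_valued_polys"
  shows "f P = g P"
proof -
  interpret G: group G by fact
  let ?R = "carrier int_valued_polys"
  define E where "E = {P \<in> ?R. f P = g P}"
  have closed: "f P \<in> carrier G" "g P \<in> carrier G" if "P \<in> ?R" for P
    using f g that by (auto simp: hom_def)
  have add: "f (P + Q) = f P \<otimes>\<^bsub>G\<^esub> f Q" "g (P + Q) = g P \<otimes>\<^bsub>G\<^esub> g Q" if "P \<in> ?R" "Q \<in> ?R" for P Q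
    using f g that by (auto simp: hom_def ivp_simps)
  have E_add: "u + v \<in> E" if "u \<in> E" "v \<in> E" for u v
    using that by (simp add: E_def add ivp.add_closed)
  have E_cancel: "u \<in> E" if "u \<in> ?R" "v \<in> E" "u + v \<in> E" for u v
    using that closed by (auto simp: E_def add)
  have "P \<in> E"
  proof (rule newton.span_induct)
    show "poly P (of_nat n) \<in> \<int>" for n
      using \<open>P \<in> ?R\<close> by (simp add: carrier_int_valued_polys)
  next
    fix c :: rat and k assume "c \<in> \<int>"
    then obtain i where c: "c = of_int i"
      by (elim Ints_cases)
    have b: "binom_poly k \<in> E"
      by (simp add: E_def eq binom_poly_closed)
    have zero: "0 \<in> E"
      by (rule E_cancel[of 0 "binom_poly k"]) (simp_all add: ivp.zero_closed b)
    have "Polynomial.smult (of_int i) (binom_poly k) \<in> E"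
    proof (induction i rule: int_induct[where k = 0])
      case base
      show ?case using zero by simp
    next
      case (step1 i)
      show ?case
        using E_add[OF step1.IH b] by (simp add: Polynomial.smult_add_left)
    next
      case (step2 i)
      show ?case
      proof (rule E_cancel[OF _ b])
        show "Polynomial.smult (of_int (i - 1)) (binom_poly k) \<in> ?R"
          by (simp add: carrier_int_valued_polys poly_binom_poly)
        show "Polynomial.smult (of_int (i - 1)) (binom_poly k) + binom_poly k \<in> E"
          using step2.IH by (simp add: Polynomial.smult_diff_left)
      qed
    qed
    then show "Polynomial.smult c (binom_poly k) \<in> E"
      by (simp add: c)
  qed (rule E_add)
  then show ?thesis
    by (simp add: E_def)
qed

text \<open>Integrality at nonnegative quantum integers suffices: it makes the Newton coefficients Laurent
  polynomials, and the quantum binomials are integral at all quantum integers.\<close>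

lemma q_int_valuedI:
  assumes "\<And>n::nat. poly P (qint (int n)) \<in> carrier laurent_ring"
  shows "P \<in> carrier q_int_valued_polys"
  using assms
proof (rule qnewton.span_induct)
  fix c k assume "c \<in> carrier laurent_ring"
  then show "Polynomial.smult c (qbinom_poly k) \<in> carrier q_int_valued_polys"
    by (simp add: carrier_q_int_valued_polys laurent.mult_closed qbinom_closed)
qed (rule qivp.add_closed)

lemma q_int_valuedD:
  "P \<in> carrier q_int_valued_polys \<Longrightarrow> poly P (qint n) \<in> carrier laurent_ring"
  by (simp add: carrier_q_int_valued_polys)

lemma smult_q_int_valued:
  "u \<in> carrier laurent_ring \<Longrightarrow> P \<in> carrier q_int_valued_polys \<Longrightarrow>
    Polynomial.smult u P \<in> carrier q_int_valued_polys"
  by (simp add: carrier_q_int_valued_polys laurent.mult_closed)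

section \<open>Reduction modulo a cyclotomic polynomial\<close>

context
  fixes d :: nat
  assumes d: "0 < d"
begin

abbreviation (input) "cyc \<equiv> poly_in_q (cyclotomic d)"
abbreviation (input) "laurent_class u \<equiv> laurent_ideal d +>\<^bsub>laurent_ring\<^esub> u"
abbreviation (input) "q_class \<equiv> qpoly_class d"
abbreviation (input) "A \<equiv> cyc_ring d"
abbreviation (input) "M \<equiv> q_quotient d"

lemma cyc_closed: "cyc \<in> carrier laurent_ring"
  by (rule poly_in_q_closed)

lemma cyc_neq_0: "cyc \<noteq> 0"
  using cyclotomic_neq_0[OF d] poly_in_q_eq_iff[of "cyclotomic d" 0] by (simp add: poly_in_q_simps)

lemma cyc_const_closed: "[:cyc:] \<in> carrier q_int_valued_polys"
  by (simp add: carrier_q_int_valued_polys cyc_closed)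

lemma laurent_ideal_eq: "laurent_ideal d = (\<lambda>s. cyc * s) ` carrier laurent_ring"
  unfolding laurent_ideal_def by (rule laurent.princ_eq[OF cyc_closed])

lemma qpoly_ideal_eq: "qpoly_ideal d = Polynomial.smult cyc ` carrier q_int_valued_polys"
  unfolding qpoly_ideal_def qivp.princ_eq[OF cyc_const_closed] by simp

lemma laurent_ideal_diff: "u \<in> laurent_ideal d \<Longrightarrow> v \<in> laurent_ideal d \<Longrightarrow> u - v \<in> laurent_ideal d"
  by (force simp: laurent_ideal_eq laurent.diff_closed simp flip: right_diff_distrib)

lemma laurent_ideal_add: "u \<in> laurent_ideal d \<Longrightarrow> v \<in> laurent_ideal d \<Longrightarrow> u + v \<in> laurent_ideal d"
  by (force simp: laurent_ideal_eq laurent.add_closed simp flip: distrib_left)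

lemma laurent_ideal_mult:
  "u \<in> carrier laurent_ring \<Longrightarrow> v \<in> laurent_ideal d \<Longrightarrow> u * v \<in> laurent_ideal d"
  by (auto simp: laurent_ideal_eq laurent.mult_closed mult.left_commute intro!: imageI)

lemma laurent_ideal_sum: "(\<And>i. i \<in> I \<Longrightarrow> h i \<in> laurent_ideal d) \<Longrightarrow> sum h I \<in> laurent_ideal d"
proof -
  have "0 \<in> laurent_ideal d"
    using laurent.zero_closed by (force simp: laurent_ideal_eq)
  then show "(\<And>i. i \<in> I \<Longrightarrow> h i \<in> laurent_ideal d) \<Longrightarrow> sum h I \<in> laurent_ideal d"
    by (induction I rule: infinite_finite_induct) (auto intro: laurent_ideal_add)
qed

lemmas laurent_class_eq_iff = laurent.coset_eq_iff[OF cyc_closed, folded laurent_ideal_def]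
lemmas A_simps = laurent.quotient_simps[OF cyc_closed, folded laurent_ideal_def, folded cyc_ring_def]
lemmas in_laurent_classD = laurent.in_cosetD[OF cyc_closed, folded laurent_ideal_def]
lemmas laurent_class_self = laurent.coset_self[OF cyc_closed, folded laurent_ideal_def]
lemmas cring_A = laurent.cring_quotient[OF cyc_closed, folded laurent_ideal_def, folded cyc_ring_def]

lemmas q_class_eq_iff = qivp.coset_eq_iff[OF cyc_const_closed, folded qpoly_ideal_def]
lemmas quot_simps = qivp.quotient_simps[OF cyc_const_closed, folded qpoly_ideal_def]
lemmas in_q_classD = qivp.in_cosetD[OF cyc_const_closed, folded qpoly_ideal_def]
lemmas q_class_self = qivp.coset_self[OF cyc_const_closed, folded qpoly_ideal_def]
lemmas cring_quot = qivp.cring_quotient[OF cyc_const_closed, folded qpoly_ideal_def]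

lemma M_fields:
  "carrier M = carrier (q_int_valued_polys Quot qpoly_ideal d)"
  "add M = add (q_int_valued_polys Quot qpoly_ideal d)"
  "monoid.mult M = monoid.mult (q_int_valued_polys Quot qpoly_ideal d)"
  "\<one>\<^bsub>M\<^esub> = \<one>\<^bsub>q_int_valued_polys Quot qpoly_ideal d\<^esub>"
  "\<zero>\<^bsub>M\<^esub> = \<zero>\<^bsub>q_int_valued_polys Quot qpoly_ideal d\<^esub>"
  by (simp_all add: q_quotient_def ring.defs)

lemmas M_simps = quot_simps[folded M_fields]

lemma comm_group_M: "comm_group (add_monoid M)"
proof (rule comm_group_cong)
  interpret Q: cring "q_int_valued_polys Quot qpoly_ideal d"
    by (rule cring_quot)
  show "comm_group (add_monoid (q_int_valued_polys Quot qpoly_ideal d))"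
    by (rule Q.a_comm_group)
qed (simp_all add: M_fields)

text \<open>The action on cosets is a union over all representatives; it has the expected value because
  the class of the product is independent of the representatives.\<close>

lemma smult_M:
  assumes u: "u \<in> carrier laurent_ring" and P: "P \<in> carrier q_int_valued_polys"
  shows "laurent_class u \<odot>\<^bsub>M\<^esub> q_class P = q_class (Polynomial.smult u P)"
proof -
  have const: "q_class (Polynomial.smult v Q) = q_class (Polynomial.smult u P)"
    if v_Q: "v \<in> laurent_class u" "Q \<in> q_class P" for v Q
  proof -
    obtain s where s: "s \<in> carrier laurent_ring" "v - u = cyc * s"
      using in_laurent_classD(2)[OF v_Q(1) u] by (auto simp: laurent_ideal_eq)
    obtain R where R: "R \<in> carrier q_int_valued_polys" "Q - P = Polynomial.smult cyc R"
      using in_q_classD(2)[OF v_Q(2) P] by (auto simp: qpoly_ideal_eq)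
    have Q: "Q \<in> carrier q_int_valued_polys"
      by (rule in_q_classD(1)[OF v_Q(2) P])
    have "Polynomial.smult v Q - Polynomial.smult u P =
        Polynomial.smult (v - u) Q + Polynomial.smult u (Q - P)"
      by (simp add: Polynomial.smult_diff_left Polynomial.smult_diff_right)
    also have "\<dots> = Polynomial.smult cyc (Polynomial.smult s Q + Polynomial.smult u R)"
      by (simp add: s R Polynomial.smult_add_right mult.commute)
    also have "\<dots> \<in> qpoly_ideal d"
      unfolding qpoly_ideal_eq by (intro imageI qivp.add_closed smult_q_int_valued s R Q u)
    finally show ?thesis
      by (simp only: q_class_eq_iff)
  qed
  have "laurent_class u \<odot>\<^bsub>M\<^esub> q_class P =
      (\<Union>v\<in>laurent_class u. \<Union>Q\<in>q_class P. q_class (Polynomial.smult v Q))"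
    by (simp add: q_quotient_def ring.defs)
  also have "\<dots> = q_class (Polynomial.smult u P)"
    using laurent_class_self[of u] q_class_self[of P] const by blast
  finally show ?thesis .
qed

lemma smult_M_hom:
  assumes "a \<in> carrier A"
  shows "(\<lambda>C. a \<odot>\<^bsub>M\<^esub> C) \<in> hom (add_monoid M) (add_monoid M)"
  by (rule homI)
    (use assms in \<open>auto simp: M_simps A_simps smult_M smult_q_int_valued qivp.add_closed Polynomial.smult_add_right\<close>)

lemma smult_M_add:
  assumes "a \<in> carrier A" "b \<in> carrier A" "C \<in> carrier M"
  shows "(a \<oplus>\<^bsub>A\<^esub> b) \<odot>\<^bsub>M\<^esub> C = a \<odot>\<^bsub>M\<^esub> C \<oplus>\<^bsub>M\<^esub> b \<odot>\<^bsub>M\<^esub> C"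
  using assms
  by (auto simp: M_simps A_simps smult_M smult_q_int_valued laurent.add_closed Polynomial.smult_add_left)

lemma smult_M_assoc:
  assumes "a \<in> carrier A" "b \<in> carrier A" "C \<in> carrier M"
  shows "(a \<otimes>\<^bsub>A\<^esub> b) \<odot>\<^bsub>M\<^esub> C = a \<odot>\<^bsub>M\<^esub> (b \<odot>\<^bsub>M\<^esub> C)"
  using assms
  by (auto simp: M_simps A_simps smult_M smult_q_int_valued laurent.mult_closed)

text \<open>Evaluation detects the ideal: dividing the polynomial by \<open>\<Phi>\<^sub>d\<close> leaves its
  values Laurent polynomials, so the quotient is again quantum integer-valued.\<close>

lemma qpoly_idealI:
  assumes "\<And>n::nat. poly P (qint (int n)) \<in> laurent_ideal d"
  shows "P \<in> qpoly_ideal d"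
proof -
  have "Polynomial.smult (inverse cyc) P \<in> carrier q_int_valued_polys"
  proof (rule q_int_valuedI)
    fix n :: nat
    show "poly (Polynomial.smult (inverse cyc) P) (qint (int n)) \<in> carrier laurent_ring"
      using assms[of n] cyc_neq_0 by (auto simp: laurent_ideal_eq simp flip: mult.assoc)
  qed
  moreover have "P = Polynomial.smult cyc (Polynomial.smult (inverse cyc) P)"
    using cyc_neq_0 by simp
  ultimately show ?thesis
    unfolding qpoly_ideal_eq by blast
qed

text \<open>The difference comes from an integer polynomial in \<open>q\<close>. At each primitive \<open>d\<close>-th
  root of unity that polynomial vanishes by the \<open>q\<close>-Lucas theorem, so it is a multiple
  of \<open>\<Phi>\<^sub>d\<close>.\<close>

lemma qbinom_congruence:
  "poly (qbinom_poly (d * k)) (qint (int n)) - const_q (of_nat ((n div d) choose k)) \<in> laurent_ideal d"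
proof -
  let ?p = "gaussian [:0, 1:] n (d * k) - [:int ((n div d) choose k):]"
  have "cyclotomic d dvd ?p"
  proof (rule cyclotomic_dvd[OF d])
    fix w assume "w \<in> primitive_roots d"
    then have w: "w ^ d = 1" "\<And>k. 0 < k \<Longrightarrow> k < d \<Longrightarrow> w ^ k \<noteq> 1"
      by (auto simp: primitive_roots_def)
    have "map_poly of_int ?p = (map_poly of_int (gaussian [:0, 1:] n (d * k)) -
        [:of_nat ((n div d) choose k):] :: complex poly)"
      by (rule poly_eqI) (simp add: coeff_map_poly coeff_pCons split: nat.split)
    then show "poly (map_poly of_int ?p) w = 0"
      using gaussian_lucas[OF d w, of n "d * k"] d by (simp add: poly_of_int_gaussian)
  qed
  then obtain r where "?p = cyclotomic d * r"
    by (elim dvdE)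
  then have "poly_in_q ?p = cyc * poly_in_q r"
    by (simp only: poly_in_q_simps)
  then have "poly_in_q ?p \<in> laurent_ideal d"
    unfolding laurent_ideal_eq using poly_in_q_closed by blast
  moreover have "const_q (of_nat ((n div d) choose k)) = poly_in_q [:int ((n div d) choose k):]"
    using const_q_of_int[of "int ((n div d) choose k)"] by simp
  ultimately show ?thesis
    by (simp only: qbinom_eq_gaussian poly_in_q_simps poly_in_q_gaussian)
qed

section \<open>The homomorphism from integer-valued polynomials\<close>

text \<open>A lift of \<open>\<Psi>\<^sub>d\<close> to polynomials. Working with the lift, additivity is an equation
  of polynomials and multiplicativity a congruence of values.\<close>

definition psi :: "rat poly \<Rightarrow> qrat poly" where
  "psi P = (\<Sum>k\<le>Polynomial.degree P. Polynomial.smult (const_q (newton.coef P k)) (qbinom_poly (d * k)))"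

lemma psi_eq:
  "Polynomial.degree P \<le> N \<Longrightarrow>
    psi P = (\<Sum>k\<le>N. Polynomial.smult (const_q (newton.coef P k)) (qbinom_poly (d * k)))"
  unfolding psi_def by (rule newton.sum_coef_extend) simp_all

lemma psi_add: "psi (P + Q) = psi P + psi Q"
proof -
  let ?N = "max (Polynomial.degree P) (Polynomial.degree Q)"
  have "Polynomial.degree (P + Q) \<le> ?N"
    by (rule Polynomial.degree_add_le_max)
  then show ?thesis
    by (simp add: psi_eq[of _ ?N] newton.coef_add const_q_simps(1) Polynomial.smult_add_left sum.distrib)
qed

lemma coef_int:
  "P \<in> carrier int_valued_polys \<Longrightarrow> newton.coef P k \<in> \<int>"
  by (rule newton.coef_closed) (simp add: carrier_int_valued_polys)

lemma psi_closed: "P \<in> carrier int_valued_polys \<Longrightarrow> psi P \<in> carrier q_int_valued_polys"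
  unfolding psi_def
  by (intro qivp.sum_closed smult_q_int_valued const_q_closed coef_int qbinom_poly_closed)

lemma psi_binom: "psi (binom_poly k) = qbinom_poly (d * k)"
proof -
  have "psi (binom_poly k) = (\<Sum>j\<le>k. if j = k then qbinom_poly (d * k) else 0)"
    unfolding psi_eq[OF newton.degree_basis]
    by (rule sum.cong) (auto simp: newton.coef_basis simp flip: one_pCons)
  then show ?thesis by simp
qed

text \<open>By linearity it suffices to treat a single binomial, where it is \<open>qbinom_congruence\<close>.\<close>

lemma psi_eval:
  assumes "P \<in> carrier int_valued_polys"
  shows "poly (psi P) (qint (int n)) - const_q (poly P (of_nat (n div d))) \<in> laurent_ideal d"
proof -
  let ?c = "newton.coef P"
  have "poly P (of_nat (n div d)) =
      poly (\<Sum>k\<le>Polynomial.degree P. Polynomial.smult (?c k) (binom_poly k)) (of_nat (n div d))"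
    by (simp only: newton.expansion[OF order_refl])
  also have "\<dots> = (\<Sum>k\<le>Polynomial.degree P. ?c k * of_nat ((n div d) choose k))"
    by (simp add: poly_sum poly_binom_poly)
  finally have "poly (psi P) (qint (int n)) - const_q (poly P (of_nat (n div d))) =
      (\<Sum>k\<le>Polynomial.degree P. const_q (?c k) *
        (poly (qbinom_poly (d * k)) (qint (int n)) - const_q (of_nat ((n div d) choose k))))"
    by (simp only: psi_def poly_sum Polynomial.poly_smult const_q_simps(2,3) right_diff_distrib sum_subtractf)
  also have "\<dots> \<in> laurent_ideal d"
    by (intro laurent_ideal_sum laurent_ideal_mult const_q_closed coef_int assms qbinom_congruence)
  finally show ?thesis .
qed

lemma psi_hom: "(\<lambda>P. q_class (psi P)) \<in> hom (add_monoid int_valued_polys) (add_monoid M)"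
  by (rule homI) (auto simp: M_simps psi_closed ivp_simps psi_add)

text \<open>Both sides have the values \<open>P (n div d) Q (n div d)\<close> modulo \<open>\<Phi>\<^sub>d\<close>, and
  values detect the ideal.\<close>

lemma psi_mult:
  assumes P: "P \<in> carrier int_valued_polys" and Q: "Q \<in> carrier int_valued_polys"
  shows "q_class (psi (P * Q)) = q_class (psi P * psi Q)"
  unfolding q_class_eq_iff
proof (rule qpoly_idealI)
  fix n :: nat
  define a b c where "a = poly (psi P) (qint (int n))" and "b = poly (psi Q) (qint (int n))"
    and "c = poly (psi (P * Q)) (qint (int n))"
  define a' b' where "a' = const_q (poly P (of_nat (n div d)))" and "b' = const_q (poly Q (of_nat (n div d)))"
  have "a' \<in> carrier laurent_ring"
    unfolding a'_def by (rule const_q_closed) (use P in \<open>simp add: carrier_int_valued_polys\<close>)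
  moreover have "b \<in> carrier laurent_ring"
    unfolding b_def by (rule q_int_valuedD[OF psi_closed[OF Q]])
  moreover have "a - a' \<in> laurent_ideal d" "b - b' \<in> laurent_ideal d"
    unfolding a_def a'_def b_def b'_def by (intro psi_eval P Q)+
  moreover have "c - a' * b' \<in> laurent_ideal d"
    using psi_eval[OF ivp.mult_closed[OF P Q], of n] by (simp only: a'_def b'_def c_def poly_mult const_q_simps(2))
  \<comment> \<open>this telescopes to \<open>c - a b\<close>\<close>
  ultimately have "(c - a' * b') - (b * (a - a') + a' * (b - b')) \<in> laurent_ideal d"
    by (intro laurent_ideal_diff[OF _ laurent_ideal_add[OF laurent_ideal_mult laurent_ideal_mult]])
  then show "poly (psi (P * Q) - psi P * psi Q) (qint (int n)) \<in> laurent_ideal d"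
    by (simp add: a_def b_def c_def algebra_simps)
qed

lemma psi_1: "psi 1 = 1"
  using psi_binom[of 0] by (simp add: binom_poly_def qbinom_poly_0 one_pCons)

lemma is_PsiD:
  assumes "is_Psi d f" "P \<in> carrier int_valued_polys"
  shows "f P = q_class (psi P)"
proof (rule ivp_hom_eqI[OF _ _ psi_hom _ assms(2)])
  show "group (add_monoid M)"
    using comm_group_M by (rule comm_group.axioms)
qed (use assms(1) in \<open>auto simp: is_Psi_def additive_maps_def psi_binom\<close>)

lemma ex1_Psi: "\<exists>!f. is_Psi d f"
proof
  let ?f = "restrict (\<lambda>P. q_class (psi P)) (carrier int_valued_polys)"
  show "is_Psi d ?f"
    using psi_hom
    by (auto simp: is_Psi_def additive_maps_def psi_binom binom_poly_closed hom_def ivp_simps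
        ivp.add_closed)
  fix f assume f: "is_Psi d f"
  show "f = ?f"
    by (rule extensionalityI[of _ "carrier int_valued_polys"])
      (use f in \<open>auto simp: is_PsiD is_Psi_def additive_maps_def\<close>)
qed

lemma Psi_ring_hom:
  assumes "is_Psi d f"
  shows "f \<in> ring_hom int_valued_polys M"
  by (rule ring_hom_memI)
    (use assms in \<open>auto simp: is_PsiD M_simps psi_closed psi_add psi_mult psi_1 ivp_simps
       ivp.add_closed ivp.mult_closed ivp.one_closed\<close>)

section \<open>Extension of scalars and the one-sided inverse\<close>

interpretation tensor int_valued_polys "cyc_ring d"
  unfolding tensor_def using ivp.cring_ring_on cring_A
  by (simp add: cring_def ring_def)

lemma is_PsiD_hom:
  assumes "is_Psi d f"
  shows "f \<in> hom (add_monoid int_valued_polys) (add_monoid M)"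
  using assms by (simp add: is_Psi_def additive_maps_def)

text \<open>The map \<open>(P, a) \<mapsto> a f(P)\<close> is biadditive. The additive map it induces is linear, because
  both sides of the linearity equation are additive in the tensor and agree on pure tensors.\<close>

lemma ex1_extension:
  assumes f: "is_Psi d f"
  shows "\<exists>!g. is_extension_of d f g"
proof -
  interpret M: comm_group "add_monoid M" by (rule comm_group_M)
  have smult_closed: "a \<odot>\<^bsub>M\<^esub> C \<in> carrier M" if "a \<in> carrier A" "C \<in> carrier M" for a C
    using smult_M_hom[OF that(1)] that(2) by (auto simp: hom_def)
  have smult_add: "a \<odot>\<^bsub>M\<^esub> (C \<oplus>\<^bsub>M\<^esub> C') = a \<odot>\<^bsub>M\<^esub> C \<oplus>\<^bsub>M\<^esub> a \<odot>\<^bsub>M\<^esub> C'"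
    if "a \<in> carrier A" "C \<in> carrier M" "C' \<in> carrier M" for a C C'
    using smult_M_hom[OF that(1)] that(2,3) by (auto simp: hom_def)
  have f_closed: "f P \<in> carrier M" if "P \<in> carrier int_valued_polys" for P
    using is_PsiD_hom[OF f] that by (auto simp: hom_def)
  have f_add: "f (P \<oplus>\<^bsub>int_valued_polys\<^esub> Q) = f P \<oplus>\<^bsub>M\<^esub> f Q"
    if "P \<in> carrier int_valued_polys" "Q \<in> carrier int_valued_polys" for P Q
    using is_PsiD_hom[OF f] that by (auto simp: hom_def)
  obtain g where g: "g \<in> hom (add_monoid (ext_ring d)) (add_monoid M)"
    and g_pure: "\<And>P a. P \<in> carrier int_valued_polys \<Longrightarrow> a \<in> carrier A \<Longrightarrow> g (ext_tensor d P a) = a \<odot>\<^bsub>M\<^esub> f P"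
    by (rule universal[of "add_monoid M" "\<lambda>P a. a \<odot>\<^bsub>M\<^esub> f P"])
      (simp_all add: comm_group_M smult_closed f_closed f_add smult_add smult_M_add)
  have g_smult: "g (a \<odot>\<^bsub>ext_ring d\<^esub> t) = a \<odot>\<^bsub>M\<^esub> g t" if a: "a \<in> carrier A" and t: "t \<in> carrier (ext_ring d)" for a t
  proof (rule T_hom_eqI[OF M.group_axioms _ _ _ t])
    show "(\<lambda>t. g (a \<odot>\<^bsub>ext_ring d\<^esub> t)) \<in> hom (add_monoid (ext_ring d)) (add_monoid M)"
      using hom_compose[OF smult_T_hom[OF a] g] by (simp add: comp_def)
    show "(\<lambda>t. a \<odot>\<^bsub>M\<^esub> g t) \<in> hom (add_monoid (ext_ring d)) (add_monoid M)"
      using hom_compose[OF g smult_M_hom[OF a]] by (simp add: comp_def)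
    fix P b assume "P \<in> carrier int_valued_polys" "b \<in> carrier A"
    then show "g (a \<odot>\<^bsub>ext_ring d\<^esub> ext_tensor d P b) = a \<odot>\<^bsub>M\<^esub> g (ext_tensor d P b)"
      using a by (simp add: smult_pure_tensor g_pure smult_M_assoc f_closed)
  qed
  have smult_T_closed: "a \<odot>\<^bsub>ext_ring d\<^esub> t \<in> carrier (ext_ring d)" if "a \<in> carrier A" "t \<in> carrier (ext_ring d)" for a t
    using smult_T_hom[OF that(1)] that(2) by (auto simp: hom_def)
  show ?thesis
  proof
    let ?g = "restrict g (carrier (ext_ring d))"
    have "?g \<in> hom (add_monoid (ext_ring d)) (add_monoid M)"
      using g comm_groupE(1)[OF comm_group_T] by (auto simp: hom_def)
    then show "is_extension_of d f ?g"
      by (auto simp: is_extension_of_def linear_maps_def additive_maps_def g_pure g_smult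
          pure_tensor_closed smult_T_closed)
    fix g' assume g': "is_extension_of d f g'"
    show "g' = ?g"
    proof (rule extensionalityI[of _ "carrier (ext_ring d)"])
      fix t assume t: "t \<in> carrier (ext_ring d)"
      have "g' t = g t"
        by (rule T_hom_eqI[OF M.group_axioms _ g _ t])
          (use g' in \<open>auto simp: is_extension_of_def linear_maps_def additive_maps_def g_pure\<close>)
      then show "g' t = ?g t"
        using t by simp
    qed (use g' in \<open>auto simp: is_extension_of_def linear_maps_def additive_maps_def\<close>)
  qed
qed

text \<open>A representative of the image of \<open>P\<close> under \<open>\<Psi>\<close>-tilde: it keeps the
  coefficients whose index is a multiple of \<open>d\<close>. The cutoff \<open>N\<close> can
  be chosen freely above the degree, since the excess terms are pure tensors with zero.\<close>

definition phi :: "nat \<Rightarrow> qrat poly \<Rightarrow> (rat poly \<times> qrat set \<Rightarrow>\<^sub>0 int)" where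
  "phi N P = (\<Sum>k\<le>N. frag_of (binom_poly k, laurent_class (qnewton.coef P (d * k))))"

lemma class_closed: "u \<in> carrier laurent_ring \<Longrightarrow> laurent_class u \<in> carrier A"
  by (simp add: A_simps)

lemma qcoef_closed: "P \<in> carrier q_int_valued_polys \<Longrightarrow> qnewton.coef P k \<in> carrier laurent_ring"
  by (rule qnewton.coef_closed) (rule q_int_valuedD)

lemma free_sum: "(\<And>i. i \<in> I \<Longrightarrow> h i \<in> carrier F) \<Longrightarrow> sum h I \<in> carrier F"
  by (induction I rule: infinite_finite_induct) (auto intro: free_closed)

lemma phi_closed: "P \<in> carrier q_int_valued_polys \<Longrightarrow> phi N P \<in> carrier F"
  unfolding phi_def by (intro free_sum free_closed binom_poly_closed class_closed qcoef_closed)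

lemma tc_phi_eq:
  assumes P: "P \<in> carrier q_int_valued_polys" and N: "Polynomial.degree P \<le> N"
  shows "tc (phi (Polynomial.degree P) P) = tc (phi N P)"
proof -
  let ?t = "\<lambda>k. frag_of (binom_poly k, laurent_class (qnewton.coef P (d * k)))"
  have "phi N P - phi (Polynomial.degree P) P = sum ?t ({..N} - {..Polynomial.degree P})"
    unfolding phi_def by (subst sum_diff) (use N in auto)
  also have "\<dots> \<in> Rel"
  proof (rule Rel_sum)
    fix k assume "k \<in> {..N} - {..Polynomial.degree P}"
    then have "Polynomial.degree P < d * k"
      using d less_le_trans[of _ k "d * k"] by simp
    then show "?t k \<in> Rel"
      using Rel_zero[OF binom_poly_closed, of k] by (simp add: qnewton.coef_eq_0 A_simps)
  qed
  finally show ?thesis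
    using tc_eq_iff[OF phi_closed[OF P] phi_closed[OF P]] by metis
qed

definition psi_tilde :: "qrat poly \<Rightarrow> (rat poly \<times> qrat set \<Rightarrow>\<^sub>0 int) set" where
  "psi_tilde P = tc (phi (Polynomial.degree P) P)"

lemma psi_tilde_eq:
  "P \<in> carrier q_int_valued_polys \<Longrightarrow> Polynomial.degree P \<le> N \<Longrightarrow> psi_tilde P = tc (phi N P)"
  unfolding psi_tilde_def by (rule tc_phi_eq)

lemma psi_tilde_closed: "P \<in> carrier q_int_valued_polys \<Longrightarrow> psi_tilde P \<in> carrier (ext_ring d)"
  by (simp add: psi_tilde_def T_simps phi_closed)

lemma psi_tilde_add:
  assumes P: "P \<in> carrier q_int_valued_polys" and Q: "Q \<in> carrier q_int_valued_polys"
  shows "psi_tilde (P + Q) = psi_tilde P \<oplus>\<^bsub>ext_ring d\<^esub> psi_tilde Q"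
proof -
  let ?N = "max (Polynomial.degree P) (Polynomial.degree Q)"
  have PQ: "P + Q \<in> carrier q_int_valued_polys"
    by (rule qivp.add_closed[OF P Q])
  have "phi ?N (P + Q) - (phi ?N P + phi ?N Q) \<in> Rel"
    unfolding phi_def sum.distrib[symmetric] sum_subtractf[symmetric]
  proof (rule Rel_sum)
    fix k
    let ?a = "qnewton.coef P (d * k)" and ?b = "qnewton.coef Q (d * k)"
    have "laurent_class (qnewton.coef (P + Q) (d * k)) = laurent_class ?a \<oplus>\<^bsub>A\<^esub> laurent_class ?b"
      by (simp add: qnewton.coef_add A_simps qcoef_closed P Q)
    then show "frag_of (binom_poly k, laurent_class (qnewton.coef (P + Q) (d * k))) -
        (frag_of (binom_poly k, laurent_class ?a) + frag_of (binom_poly k, laurent_class ?b)) \<in> Rel"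
      using Rel_right[OF binom_poly_closed class_closed class_closed, of ?a ?b k] P Q
      by (simp add: qcoef_closed diff_diff_eq)
  qed
  then have "tc (phi ?N (P + Q)) = tc (phi ?N P + phi ?N Q)"
    by (simp add: tc_eq_iff free_closed phi_closed P Q PQ)
  moreover have "Polynomial.degree (P + Q) \<le> ?N"
    by (rule Polynomial.degree_add_le_max)
  ultimately show ?thesis
    by (simp add: psi_tilde_eq[of _ ?N] P Q PQ T_simps phi_closed)
qed

lemma psi_tilde_smult:
  assumes u: "u \<in> carrier laurent_ring" and P: "P \<in> carrier q_int_valued_polys"
  shows "psi_tilde (Polynomial.smult u P) = laurent_class u \<odot>\<^bsub>ext_ring d\<^esub> psi_tilde P"
proof -
  let ?N = "Polynomial.degree P"
  have "scale (laurent_class u) (phi ?N P) = phi ?N (Polynomial.smult u P)"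
    by (simp add: phi_def frag_extend_sum qnewton.coef_smult A_simps u P qcoef_closed)
  then show ?thesis
    using psi_tilde_eq[OF smult_q_int_valued[OF u P] Polynomial.degree_smult_le]
    by (simp add: psi_tilde_def smult_tc class_closed u phi_closed P)
qed

text \<open>Coefficients are linear over Laurent polynomials, so polynomials that are congruent modulo
  \<open>\<Phi>\<^sub>d\<close> have congruent coefficients.\<close>

lemma psi_tilde_cong:
  assumes P: "P \<in> carrier q_int_valued_polys" and Q: "Q \<in> carrier q_int_valued_polys"
    and eq: "q_class P = q_class Q"
  shows "psi_tilde P = psi_tilde Q"
proof -
  let ?N = "max (Polynomial.degree P) (Polynomial.degree Q)"
  obtain R where R: "R \<in> carrier q_int_valued_polys" "P - Q = Polynomial.smult cyc R"
    using eq unfolding q_class_eq_iff by (auto simp: qpoly_ideal_eq)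
  have "laurent_class (qnewton.coef P k) = laurent_class (qnewton.coef Q k)" for k
  proof -
    have "P = Q + Polynomial.smult cyc R"
      using R(2) by (simp add: algebra_simps)
    then have "qnewton.coef P k - qnewton.coef Q k = cyc * qnewton.coef R k"
      by (simp add: qnewton.coef_add qnewton.coef_smult)
    then show ?thesis
      using qcoef_closed[OF R(1)] unfolding laurent_class_eq_iff by (auto simp: laurent_ideal_eq)
  qed
  then have "phi ?N P = phi ?N Q"
    by (simp add: phi_def)
  then show ?thesis
    by (simp add: psi_tilde_eq[of _ ?N] P Q)
qed

lemma psi_tilde_qbinom:
  "psi_tilde (qbinom_poly k) =
    (if d dvd k then ext_tensor d (binom_poly (k div d)) \<one>\<^bsub>A\<^esub> else \<zero>\<^bsub>ext_ring d\<^esub>)"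
proof -
  \<comment> \<open>a representative of the claimed value\<close>
  define c where "c = (if d dvd k then frag_of (binom_poly (k div d), \<one>\<^bsub>A\<^esub>) else 0)"
  let ?t = "\<lambda>j. frag_of (binom_poly j, laurent_class (if d * j = k then 1 else 0))"
  have phi: "phi k (qbinom_poly k) = sum ?t {..k}"
    by (simp add: phi_def qnewton.coef_basis)
  have c_closed: "c \<in> carrier F"
    by (simp add: c_def free_closed binom_poly_closed A.one_closed)
  have "c = (\<Sum>j\<le>k. if d * j = k then frag_of (binom_poly j, \<one>\<^bsub>A\<^esub>) else 0)"
  proof (cases "d dvd k")
    case True
    then obtain m where k: "k = d * m" by blast
    have "(\<Sum>j\<le>k. if d * j = k then frag_of (binom_poly j, \<one>\<^bsub>A\<^esub>) else 0) =
        (\<Sum>j\<le>k. if j = m then frag_of (binom_poly m, \<one>\<^bsub>A\<^esub>) else 0)"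
      by (rule sum.cong) (use d k in auto)
    moreover have "m \<le> k" using d k by simp
    ultimately show ?thesis
      using d k by (simp add: c_def)
  next
    case False
    then have "d * j \<noteq> k" for j by auto
    with False show ?thesis by (simp add: c_def)
  qed
  then have "phi k (qbinom_poly k) - c =
      (\<Sum>j\<le>k. ?t j - (if d * j = k then frag_of (binom_poly j, \<one>\<^bsub>A\<^esub>) else 0))"
    by (simp only: phi sum_subtractf)
  also have "\<dots> \<in> Rel"
    by (rule Rel_sum) (use Rel_zero[OF binom_poly_closed] in \<open>simp add: A_simps Rel_closed\<close>)
  finally have "tc (phi k (qbinom_poly k)) = tc c"
    by (simp add: tc_eq_iff phi_closed qbinom_poly_closed c_closed)
  then show ?thesis
    unfolding psi_tilde_eq[OF qbinom_poly_closed qnewton.degree_basis]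
    by (simp add: c_def pure_tensor_def T_simps)
qed

lemma ex1_Psi_tilde: "\<exists>!h. is_Psi_tilde d h"
proof
  define h where "h = restrict (\<lambda>C. psi_tilde (SOME P. P \<in> carrier q_int_valued_polys \<and> q_class P = C)) (carrier M)"
  have h: "h (q_class P) = psi_tilde P" if P: "P \<in> carrier q_int_valued_polys" for P
  proof -
    let ?Q = "SOME Q. Q \<in> carrier q_int_valued_polys \<and> q_class Q = q_class P"
    have "?Q \<in> carrier q_int_valued_polys \<and> q_class ?Q = q_class P"
      by (rule someI[of _ P]) (simp add: P)
    then have "psi_tilde ?Q = psi_tilde P"
      using P psi_tilde_cong by blast
    moreover have "q_class P \<in> carrier M"
      using P by (simp add: M_simps)
    ultimately show ?thesis
      by (simp add: h_def)
  qed
  show "is_Psi_tilde d h"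
    unfolding is_Psi_tilde_def linear_maps_def additive_maps_def
  proof (intro conjI CollectI IntI ballI allI)
    show "h \<in> extensional (carrier M)"
      by (simp add: h_def)
    show "h \<in> hom (add_monoid M) (add_monoid (ext_ring d))"
      by (rule homI) (auto simp: M_simps h psi_tilde_closed qivp.add_closed psi_tilde_add)
    show "h (a \<odot>\<^bsub>M\<^esub> C) = a \<odot>\<^bsub>ext_ring d\<^esub> h C" if "a \<in> carrier A" "C \<in> carrier M" for a C
      using that by (auto simp: M_simps A_simps h smult_M smult_q_int_valued psi_tilde_smult)
  qed (simp add: h qbinom_poly_closed psi_tilde_qbinom)
  fix h' assume h': "is_Psi_tilde d h'"
  then have h'_hom: "h' \<in> hom (add_monoid M) (add_monoid (ext_ring d))"
    and h'_smult: "\<And>a C. a \<in> carrier A \<Longrightarrow> C \<in> carrier M \<Longrightarrow> h' (a \<odot>\<^bsub>M\<^esub> C) = a \<odot>\<^bsub>ext_ring d\<^esub> h' C"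
    by (auto simp: is_Psi_tilde_def linear_maps_def additive_maps_def)
  have class_in_M: "q_class P \<in> carrier M" if "P \<in> carrier q_int_valued_polys" for P
    using that by (simp add: M_simps)
  show "h' = h"
  proof (rule extensionalityI[of _ "carrier M"])
    fix C assume "C \<in> carrier M"
    then obtain P where P: "P \<in> carrier q_int_valued_polys" "C = q_class P"
      by (auto simp: M_simps)
    have add: "h' (q_class (P + Q)) = h' (q_class P) \<oplus>\<^bsub>ext_ring d\<^esub> h' (q_class Q)"
      if "P \<in> carrier q_int_valued_polys" "Q \<in> carrier q_int_valued_polys" for P Q
    proof -
      have "h' (q_class P \<oplus>\<^bsub>M\<^esub> q_class Q) = h' (q_class P) \<oplus>\<^bsub>ext_ring d\<^esub> h' (q_class Q)"
        using hom_mult[OF h'_hom, of "q_class P" "q_class Q"] class_in_M that by simp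
      then show ?thesis
        using that by (simp add: M_simps)
    qed
    have smult: "h' (q_class (Polynomial.smult c (qbinom_poly k))) =
        laurent_class c \<odot>\<^bsub>ext_ring d\<^esub> h' (q_class (qbinom_poly k))"
      if "c \<in> carrier laurent_ring" for c k
    proof -
      have "h' (laurent_class c \<odot>\<^bsub>M\<^esub> q_class (qbinom_poly k)) =
          laurent_class c \<odot>\<^bsub>ext_ring d\<^esub> h' (q_class (qbinom_poly k))"
        by (rule h'_smult[OF class_closed[OF that] class_in_M[OF qbinom_poly_closed]])
      then show ?thesis
        using that by (simp add: smult_M qbinom_poly_closed)
    qed
    have "P \<in> carrier q_int_valued_polys \<and> h' (q_class P) = psi_tilde P"
    proof (rule qnewton.span_induct[of P])
      show "poly P (qint (int n)) \<in> carrier laurent_ring" for n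
        by (rule q_int_valuedD[OF P(1)])
    next
      fix c k assume c: "c \<in> carrier laurent_ring"
      have "h' (q_class (qbinom_poly k)) = psi_tilde (qbinom_poly k)"
        using h' by (simp add: is_Psi_tilde_def psi_tilde_qbinom)
      then show "Polynomial.smult c (qbinom_poly k) \<in> carrier q_int_valued_polys \<and>
          h' (q_class (Polynomial.smult c (qbinom_poly k))) = psi_tilde (Polynomial.smult c (qbinom_poly k))"
        using c by (simp add: smult psi_tilde_smult qbinom_poly_closed smult_q_int_valued)
    qed (simp add: add psi_tilde_add qivp.add_closed)
    then show "h' C = h C"
      using P h by simp
  qed (use h' in \<open>auto simp: is_Psi_tilde_def linear_maps_def additive_maps_def h_def\<close>)
qed

text \<open>Additivity and linearity reduce the claim to the tensors of a binomial with \<open>1\<close>.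
  The index \<open>d k\<close> in the image of such a tensor is divisible by \<open>d\<close>, with
  quotient \<open>k\<close>.\<close>

lemma Psi_tilde_inverse:
  assumes f: "is_Psi d f" and g: "is_extension_of d f g" and h: "is_Psi_tilde d h"
    and t: "t \<in> carrier (ext_ring d)"
  shows "h (g t) = t"
proof -
  have group_T: "group (add_monoid (ext_ring d))"
    using comm_group_T by (rule comm_group.axioms)
  have f_hom: "f \<in> hom (add_monoid int_valued_polys) (add_monoid M)"
    by (rule is_PsiD_hom[OF f])
  have g_hom: "g \<in> hom (add_monoid (ext_ring d)) (add_monoid M)"
    and g_pure: "\<And>P a. P \<in> carrier int_valued_polys \<Longrightarrow> a \<in> carrier A \<Longrightarrow> g (ext_tensor d P a) = a \<odot>\<^bsub>M\<^esub> f P"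
    using g by (auto simp: is_extension_of_def linear_maps_def additive_maps_def)
  have h_hom: "h \<in> hom (add_monoid M) (add_monoid (ext_ring d))"
    and h_smult: "\<And>a C. a \<in> carrier A \<Longrightarrow> C \<in> carrier M \<Longrightarrow> h (a \<odot>\<^bsub>M\<^esub> C) = a \<odot>\<^bsub>ext_ring d\<^esub> h C"
    and h_basis: "\<And>k. h (q_class (qbinom_poly k)) =
      (if d dvd k then ext_tensor d (binom_poly (k div d)) \<one>\<^bsub>A\<^esub> else \<zero>\<^bsub>ext_ring d\<^esub>)"
    using h by (auto simp: is_Psi_tilde_def linear_maps_def additive_maps_def)
  have hf: "h (f P) = ext_tensor d P \<one>\<^bsub>A\<^esub>" if P: "P \<in> carrier int_valued_polys" for P
  proof (rule ivp_hom_eqI[OF group_T _ _ _ P])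
    show "(\<lambda>P. h (f P)) \<in> hom (add_monoid int_valued_polys) (add_monoid (ext_ring d))"
      using hom_compose[OF f_hom h_hom] by (simp add: comp_def)
    show "(\<lambda>P. ext_tensor d P \<one>\<^bsub>A\<^esub>) \<in> hom (add_monoid int_valued_polys) (add_monoid (ext_ring d))"
      by (rule homI) (simp_all add: pure_tensor_closed pure_tensor_add_left A.one_closed)
    fix k
    have "f (binom_poly k) = q_class (qbinom_poly (d * k))"
      using f by (simp add: is_Psi_def)
    then show "h (f (binom_poly k)) = ext_tensor d (binom_poly k) \<one>\<^bsub>A\<^esub>"
      using d by (simp add: h_basis)
  qed
  show ?thesis
  proof (rule T_hom_eqI[OF group_T _ _ _ t])
    show "(\<lambda>t. h (g t)) \<in> hom (add_monoid (ext_ring d)) (add_monoid (ext_ring d))"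
      using hom_compose[OF g_hom h_hom] by (simp add: comp_def)
    show "(\<lambda>t. t) \<in> hom (add_monoid (ext_ring d)) (add_monoid (ext_ring d))"
      by (rule homI) auto
    fix P a assume P: "P \<in> carrier int_valued_polys" and a: "a \<in> carrier A"
    have "f P \<in> carrier M"
      using f_hom P by (auto simp: hom_def)
    then have "h (g (ext_tensor d P a)) = a \<odot>\<^bsub>ext_ring d\<^esub> ext_tensor d P \<one>\<^bsub>A\<^esub>"
      by (simp add: g_pure P a h_smult hf)
    also have "\<dots> = ext_tensor d P a"
      by (simp add: smult_pure_tensor P a A.one_closed A.r_one)
    finally show "h (g (ext_tensor d P a)) = ext_tensor d P a" .
  qed
qed

end

theorem corollary7p5:
  fixes d :: nat
  assumes "d > 0"
  shows "(\<exists>!f. is_Psi d f) \<and>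
     (\<forall>f. is_Psi d f \<longrightarrow> f \<in> ring_hom int_valued_polys (q_quotient d)) \<and>
     (\<exists>!h. is_Psi_tilde d h) \<and>
     (\<forall>f. is_Psi d f \<longrightarrow>
        (\<exists>!g. is_extension_of d f g) \<and>
        (\<forall>g h. is_extension_of d f g \<longrightarrow> is_Psi_tilde d h \<longrightarrow>
           (\<forall>t\<in>carrier (ext_ring d). h (g t) = t)))"
proof (intro conjI allI impI ballI)
  show "\<exists>!f. is_Psi d f"
    by (rule ex1_Psi[OF assms])
  show "\<exists>!h. is_Psi_tilde d h"
    by (rule ex1_Psi_tilde[OF assms])
  fix f assume f: "is_Psi d f"
  show "f \<in> ring_hom int_valued_polys (q_quotient d)"
    by (rule Psi_ring_hom[OF assms f])
  show "\<exists>!g. is_extension_of d f g"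
    by (rule ex1_extension[OF assms f])
  fix g h t
  assume "is_extension_of d f g" "is_Psi_tilde d h" "t \<in> carrier (ext_ring d)"
  then show "h (g t) = t"
    by (rule Psi_tilde_inverse[OF assms f])
qed

end
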